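(* Let $\mathcal{H}$ be a separable real Hilbert space and let $\mathrm{Q}\in\mathcal{P}(\mathcal{H})$. (i) If $\mathrm{P}\in\mathcal{P}^{\ell}(\mathcal{H})$, then there exists a gradient of a convex function $\nabla\psi$ (with $\psi:\mathcal{H}\to(-\infty,+\infty]$ proper, lower semicontinuous and convex) pushing $\mathrm{P}$ forward to $\mathrm{Q}$, i.e. $\nabla\psi\#\mathrm{P}=\mathrm{Q}$. (ii) If $\mathrm{P}\in\mathcal{P}^{\ell}(\mathcal{H})$ and $\operatorname{supp}(\mathrm{Q})$ is bounded, then such a $\nabla\psi$ is unique $\mathrm{P}$-a.s.; that is, if $\psi_1,\psi_2$ are proper lower semicontinuous convex functions with $\nabla\psi_1\#\mathrm{P}=\nabla\psi_2\#\mathrm{P}=\mathrm{Q}$, then $\nabla\psi_1=\nabla\psi_2$ $\mathrm{P}$-almost surely.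
   Context: $\mathcal{P}(\mathcal{H})$ is the set of Borel probability measures on $\mathcal{H}$ (with inner product $\langle\cdot,\cdot\rangle$ and norm $\|\cdot\|$); $\operatorname{supp}$ denotes the (closed) support. Lipschitz hypersurface: a set of the form $\{z+\tau(z)v:\ z\in Z\}$, where $v\in\mathcal{H}\setminus\{0\}$, $Z=\{\lambda v:\lambda\in\mathbb{R}\}^{\perp}$, and $\tau:\mathcal{H}\to\mathbb{R}$ is a Lipschitz function. $\mathcal{P}^{\ell}(\mathcal{H})$ is the set of $\mathrm{P}\in\mathcal{P}(\mathcal{H})$ giving mass zero to every Lipschitz hypersurface. For a proper lower semicontinuous convex $f:\mathcal{H}\to(-\infty,+\infty]$, $\partial f(x)=\{y\in\mathcal{H}:\ f(x)+\langle y,z-x\rangle\le f(z)\ \forall z\in\mathcal{H}\}$; $\operatorname{dom}(\nabla f)=\{x\in\mathcal{H}:\partial f(x)\text{ is a singleton}\}$, and for $x\in\operatorname{dom}(\nabla f)$, $\nabla f(x)$ denotes the unique element of $\partial f(x)$. $\nabla\psi\#\mathrm{P}=\mathrm{Q}$ means that $\mathrm{P}(\operatorname{dom}(\nabla\psi))=1$ and $\mathrm{P}(\{x\in\operatorname{dom}(\nabla\psi):\nabla\psi(x)\in B\})=\mathrm{Q}(B)$ for every Borel $B\subseteq\mathcal{H}$. *)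

theory Defs
  imports "HOL-Probability.Probability"
begin

definition borel_prob_measures :: "'a::topological_space measure set" where
  "borel_prob_measures = {M. sets M = sets borel \<and> prob_space M}"

definition measure_supp :: "'a::topological_space measure \<Rightarrow> 'a set" where
  "measure_supp M = {x. \<forall>U. open U \<longrightarrow> x \<in> U \<longrightarrow> emeasure M U > 0}"

definition lipschitz_hypersurface :: "'a::real_inner set \<Rightarrow> bool" where
  "lipschitz_hypersurface S \<longleftrightarrow>
     (\<exists>v \<tau> L. v \<noteq> 0 \<and> L-lipschitz_on UNIV (\<tau> :: 'a \<Rightarrow> real) \<and>
        S = {z + \<tau> z *\<^sub>R v | z. z \<in> {c *\<^sub>R v | c. c \<in> UNIV}\<^sup>\<bottom>})"

text \<open>Lipschitz hypersurfaces are closed, hence Borel, so the value 0 below is never the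
  default value that \<^const>\<open>emeasure\<close> takes on non-measurable sets.\<close>

definition lipschitz_null_measures :: "'a::real_inner measure set" where
  "lipschitz_null_measures =
     {P \<in> borel_prob_measures. \<forall>S. lipschitz_hypersurface S \<longrightarrow> emeasure P S = 0}"

definition proper_fun :: "('a \<Rightarrow> ereal) \<Rightarrow> bool" where
  "proper_fun f \<longleftrightarrow> (\<forall>x. f x \<noteq> -\<infinity>) \<and> (\<exists>x. f x \<noteq> \<infinity>)"

definition lsc_fun :: "('a::topological_space \<Rightarrow> ereal) \<Rightarrow> bool" where
  "lsc_fun f \<longleftrightarrow> (\<forall>x. f x \<le> Liminf (at x) f)"

definition convex_fun :: "('a::real_vector \<Rightarrow> ereal) \<Rightarrow> bool" where
  "convex_fun f \<longleftrightarrow> (\<forall>x y t. 0 < t \<and> t < 1 \<longrightarrow>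
     f ((1 - t) *\<^sub>R x + t *\<^sub>R y) \<le> ereal (1 - t) * f x + ereal t * f y)"

definition proper_lsc_convex :: "('a::real_inner \<Rightarrow> ereal) \<Rightarrow> bool" where
  "proper_lsc_convex f \<longleftrightarrow> proper_fun f \<and> lsc_fun f \<and> convex_fun f"

definition subdifferential :: "('a::real_inner \<Rightarrow> ereal) \<Rightarrow> 'a \<Rightarrow> 'a set" where
  "subdifferential f x = {y. \<forall>z. f x + ereal (y \<bullet> (z - x)) \<le> f z}"

definition dom_grad :: "('a::real_inner \<Rightarrow> ereal) \<Rightarrow> 'a set" where
  "dom_grad f = {x. is_singleton (subdifferential f x)}"

text \<open>Only meaningful on \<^const>\<open>dom_grad\<close>; unspecified elsewhere.\<close>

definition grad :: "('a::real_inner \<Rightarrow> ereal) \<Rightarrow> 'a \<Rightarrow> 'a" where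
  "grad f x = the_elem (subdifferential f x)"

definition grad_pushes :: "('a::real_inner \<Rightarrow> ereal) \<Rightarrow> 'a measure \<Rightarrow> 'a measure \<Rightarrow> bool" where
  "grad_pushes \<psi> P Q \<longleftrightarrow>
     emeasure P (dom_grad \<psi>) = 1 \<and>
     (\<forall>B \<in> sets borel. emeasure P {x \<in> dom_grad \<psi>. grad \<psi> x \<in> B} = emeasure Q B)"

end

theory Submission
  imports Defs
begin

text \<open>
  Existence. Discretise the space by nearest points of a dense sequence, take optimal couplings of the
  resulting finite distributions (their supports are cyclically monotone by optimality), and lift
  them to finitely additive couplings of \<open>P\<close> and \<open>Q\<close>. These are functions from sets to \<open>[0, 1]\<close>, so by
  Tychonoff they have a cluster point; it is again a finitely additive coupling, and since its
  marginals are Radon it is countably additive on a generating algebra. Its support is cyclically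
  monotone, hence contained in the graph of a subdifferential \<open>\<partial>\<psi>\<close> (Rockafellar). Points at which
  \<open>\<partial>\<psi>\<close> has two elements lie in countably many Lipschitz hypersurfaces (Zajicek) and are \<open>P\<close>-null.

  Uniqueness. Let \<open>u = \<psi>1 - \<psi>2\<close> and \<open>w = \<psi>1* - \<psi>2*\<close> with the convex conjugates. The Fenchel-Young
  inequality and its equality case give \<open>w(\<nabla>\<psi>1) \<le> -u \<le> w(\<nabla>\<psi>2)\<close> almost surely. The outer terms have
  the same law, so all three agree, which is the equality case \<open>\<nabla>\<psi>2(x) \<in> \<partial>\<psi>1(x)\<close>.
\<close>

text \<open>No moments of \<open>P\<close> and \<open>Q\<close> are assumed, so the integral of the
  inner product against a coupling of \<open>P\<close> and \<open>Q\<close> need not exist, and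
  there is no optimisation problem for \<open>P\<close> and \<open>Q\<close> themselves to start
  from. Optimality is used only for finite distributions; what survives the limit is cyclical
  monotonicity, a closed condition on finitely many points at a time. Uniqueness meets the same
  obstacle: u and w need not be integrable, so equality is drawn from equal laws by means of a
  bounded strictly increasing function. A second obstacle is infinite dimension, where bounded sets
  of subgradients need not be relatively compact in norm. All measurability statements are therefore
  reduced to one closedness statement, about the points that have a pair of subgradients in a given
  closed bounded convex set; convexity makes up for the missing compactness.\<close>

subsection \<open>Nested convex sets in a Hilbert space\<close>

text \<open>Points of almost minimal norm form a Cauchy sequence: the midpoint of \<open>x n\<close>
  and a later \<open>x m\<close> stays in \<open>K n\<close>, so the parallelogram law bounds their
  distance by the gap between the minimal norms. These increase with \<open>n\<close> and are
  bounded because \<open>K 0\<close> is, so the gaps vanish.\<close>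

lemma nested_closed_convex_Inter_nonempty:
  fixes K :: "nat \<Rightarrow> 'a::{real_inner, complete_space} set"
  assumes closed: "\<And>n. closed (K n)" and convex: "\<And>n. convex (K n)"
    and nonempty: "\<And>n. K n \<noteq> {}" and dec: "decseq K" and bounded: "bounded (K 0)"
  shows "(\<Inter>n. K n) \<noteq> {}"
proof -
  define q where "q n = (INF x\<in>K n. (norm x)\<^sup>2)" for n
  have bdd: "bdd_below ((\<lambda>x. (norm x)\<^sup>2) ` K n)" for n
    by (rule bdd_belowI[of _ 0]) auto
  have q_le: "q n \<le> (norm x)\<^sup>2" if "x \<in> K n" for n x
    unfolding q_def by (rule cINF_lower[OF bdd that])
  have sub: "K m \<subseteq> K n" if "n \<le> m" for n m
    using dec that by (auto simp: decseq_def)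
  have "\<exists>x\<in>K n. (norm x)\<^sup>2 < q n + 1 / Suc n" for n
    using cINF_less_iff[OF nonempty bdd, of n "q n + 1 / Suc n"] by (auto simp: q_def)
  then obtain x where x: "\<And>n. x n \<in> K n" "\<And>n. (norm (x n))\<^sup>2 < q n + 1 / Suc n"
    by metis
  have inc: "incseq q"
    unfolding incseq_def q_def using sub by (auto intro!: cINF_superset_mono nonempty bdd)
  obtain B where B: "\<And>x. x \<in> K 0 \<Longrightarrow> norm x \<le> B"
    using bounded by (auto simp: bounded_iff)
  have "q n \<le> B\<^sup>2" for n
  proof -
    have "q n \<le> (norm (x n))\<^sup>2" by (rule q_le[OF x(1)])
    also have "\<dots> \<le> B\<^sup>2"
      using B[of "x n"] x(1)[of n] sub[of 0 n] by (intro power_mono) auto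
    finally show ?thesis .
  qed
  then obtain L where L: "q \<longlonglongrightarrow> L" "\<forall>n. q n \<le> L"
    using incseq_convergent[OF inc] by auto
  \<comment> \<open>What the parallelogram law leaves: twice \<open>q n + 1 / Suc n\<close> plus
    twice \<open>q m + 1 / Suc m\<close> minus \<open>4 * q n\<close>, estimated by
    \<open>q m \<le> L\<close> and \<open>1 / Suc m \<le> 1 / Suc n\<close>.\<close>
  define e where "e n = 2 * (L - q n) + 4 / Suc n" for n
  have "(\<lambda>n. 4 / real (Suc n)) \<longlonglongrightarrow> 0"
    using LIMSEQ_Suc[OF lim_const_over_n[of "4::real"]] by simp
  then have "(\<lambda>n. 2 * (L - q n) + 4 / Suc n) \<longlonglongrightarrow> 2 * (L - L) + 0"
    by (intro tendsto_intros L)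
  then have e: "e \<longlonglongrightarrow> 0"
    by (simp add: e_def[abs_def])
  have dist: "(norm (x n - x m))\<^sup>2 \<le> e n" if "n \<le> m" for n m
  proof -
    let ?z = "(1/2) *\<^sub>R x n + (1/2) *\<^sub>R x m"
    have "?z \<in> K n"
      using convexD[OF convex, of "x n" n "x m" "1/2" "1/2"] x(1) sub[OF that] by auto
    then have "q n \<le> (norm ?z)\<^sup>2" by (rule q_le)
    moreover have "(norm (x n - x m))\<^sup>2 + 4 * (norm ?z)\<^sup>2 = 2 * (norm (x n))\<^sup>2 + 2 * (norm (x m))\<^sup>2"
      by (simp add: power2_norm_eq_inner algebra_simps inner_commute)
    moreover have "(1::real) / Suc m \<le> 1 / Suc n" using that by (simp add: field_simps)
    ultimately show ?thesis
      using x(2)[of n] x(2)[of m] L(2)[rule_format, of m] by (simp add: e_def)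
  qed
  have "Cauchy x"
  proof (rule metric_CauchyI)
    fix r :: real assume "r > 0"
    then have "\<forall>\<^sub>F n in sequentially. e n < (r/2)\<^sup>2"
      by (intro order_tendstoD[OF e]) auto
    then obtain N where N: "\<And>n. n \<ge> N \<Longrightarrow> e n < (r/2)\<^sup>2"
      by (auto simp: eventually_sequentially)
    have near: "dist (x N) (x m) < r / 2" if "m \<ge> N" for m
    proof -
      have "(norm (x N - x m))\<^sup>2 < (r/2)\<^sup>2" using dist[OF that] N[of N] by simp
      then show ?thesis
        unfolding dist_norm by (rule power2_less_imp_less) (use \<open>r > 0\<close> in simp)
    qed
    have "dist (x m) (x n) < r" if "m \<ge> N" "n \<ge> N" for m n
      using near[OF that(1)] near[OF that(2)] dist_triangle3[of "x m" "x n" "x N"] by simp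
    then show "\<exists>M. \<forall>m\<ge>M. \<forall>n\<ge>M. dist (x m) (x n) < r" by blast
  qed
  then obtain l where l: "x \<longlonglongrightarrow> l"
    using Cauchy_convergent convergent_def by blast
  have "l \<in> K n" for n
  proof (rule Lim_in_closed_set[OF closed _ _ l])
    show "\<forall>\<^sub>F m in sequentially. x m \<in> K n"
      unfolding eventually_sequentially using x(1) sub by blast
  qed auto
  then show ?thesis by blast
qed

subsection \<open>Subdifferentials\<close>

lemma lsc_fun_open:
  assumes "lsc_fun f" shows "open {x. c < f x}"
proof (subst open_subopen, intro ballI)
  fix x assume "x \<in> {x. c < f x}"
  then have "c < f x" by simp
  then have "\<forall>\<^sub>F z in at x. c < f z"
    using assms unfolding lsc_fun_def le_Liminf_iff by blast
  then have "\<forall>\<^sub>F z in nhds x. c < f z"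
    unfolding eventually_at_filter by (rule eventually_mono) (use \<open>c < f x\<close> in blast)
  then show "\<exists>T. open T \<and> x \<in> T \<and> T \<subseteq> {x. c < f x}"
    by (auto simp: eventually_nhds)
qed

lemma lsc_funI:
  assumes "\<And>c. open {x. c < f x}" shows "lsc_fun f"
  unfolding lsc_fun_def le_Liminf_iff
proof (intro allI impI)
  fix x c assume "c < f x"
  then have "\<forall>\<^sub>F z in nhds x. c < f z"
    using assms[of c] by (auto simp: eventually_nhds)
  then show "\<forall>\<^sub>F z in at x. c < f z"
    by (auto simp: eventually_at_filter elim: eventually_mono)
qed

lemma lsc_fun_borel_measurable: "lsc_fun f \<Longrightarrow> f \<in> borel_measurable borel"
  by (rule borel_measurableI_greater) (simp add: greaterThan_def vimage_def lsc_fun_open)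

lemma lsc_fun_SUP_continuous:
  fixes g :: "'i \<Rightarrow> 'a::topological_space \<Rightarrow> real"
  assumes "\<And>i. i \<in> I \<Longrightarrow> continuous_on UNIV (g i)"
  shows "lsc_fun (\<lambda>x. SUP i\<in>I. ereal (g i x))"
proof (rule lsc_funI)
  fix c
  have "{x. c < (SUP i\<in>I. ereal (g i x))} = (\<Union>i\<in>I. (\<lambda>x. ereal (g i x)) -` {c<..})"
    by (auto simp: less_SUP_iff)
  moreover have "open ((\<lambda>x. ereal (g i x)) -` {c<..})" if "i \<in> I" for i
    by (rule open_vimage) (auto intro!: continuous_on_ereal assms that)
  ultimately show "open {x. c < (SUP i\<in>I. ereal (g i x))}" by auto
qed

lemma subdifferential_finite:
  assumes "proper_fun f" "y \<in> subdifferential f x"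
  shows "\<bar>f x\<bar> \<noteq> \<infinity>"
proof -
  obtain z where z: "f z \<noteq> \<infinity>" using assms by (auto simp: proper_fun_def)
  have "f x + ereal (y \<bullet> (z - x)) \<le> f z" using assms by (auto simp: subdifferential_def)
  then have "f x \<noteq> \<infinity>" using z by auto
  moreover have "f x \<noteq> -\<infinity>" using assms by (auto simp: proper_fun_def)
  ultimately show ?thesis by auto
qed

lemma subdifferential_monotone:
  assumes f: "proper_fun f" and y: "y \<in> subdifferential f x" and y': "y' \<in> subdifferential f x'"
  shows "0 \<le> (y - y') \<bullet> (x - x')"
proof -
  obtain a b where a: "f x = ereal a" and b: "f x' = ereal b"
    using subdifferential_finite[OF f y] subdifferential_finite[OF f y'] by auto
  have "f x + ereal (y \<bullet> (x' - x)) \<le> f x'" "f x' + ereal (y' \<bullet> (x - x')) \<le> f x"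
    using y y' by (auto simp: subdifferential_def)
  then have "a + y \<bullet> (x' - x) \<le> b" "b + y' \<bullet> (x - x') \<le> a" by (auto simp: a b)
  then show ?thesis by (simp add: inner_diff_left inner_diff_right)
qed

text \<open>One device for three purposes, depending on \<open>C\<close>: separated pairs detect
  several subgradients, products of large balls detect at least one, and the product of a small ball
  with itself describes preimages under the gradient.\<close>

definition subgradient_pair_dom :: "('a::real_inner \<Rightarrow> ereal) \<Rightarrow> ('a \<times> 'a) set \<Rightarrow> 'a set" where
  "subgradient_pair_dom f C =
     {x. \<exists>y y'. (y, y') \<in> C \<and> y \<in> subdifferential f x \<and> y' \<in> subdifferential f x}"

lemma closed_halfspace_pair:
  fixes a b :: "'a::real_inner"
  shows "closed {p :: 'a \<times> 'a. fst p \<bullet> a \<le> c}" "closed {p :: 'a \<times> 'a. snd p \<bullet> b \<le> c}"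
    and "convex {p :: 'a \<times> 'a. fst p \<bullet> a \<le> c}" "convex {p :: 'a \<times> 'a. snd p \<bullet> b \<le> c}"
proof -
  have 1: "fst p \<bullet> a = (a, 0) \<bullet> p" "snd p \<bullet> b = (0, b) \<bullet> p" for p :: "'a \<times> 'a"
    by (auto simp: inner_prod_def inner_commute)
  show "closed {p :: 'a \<times> 'a. fst p \<bullet> a \<le> c}" "closed {p :: 'a \<times> 'a. snd p \<bullet> b \<le> c}"
    by (simp_all only: 1 closed_halfspace_le)
  show "convex {p :: 'a \<times> 'a. fst p \<bullet> a \<le> c}" "convex {p :: 'a \<times> 'a. snd p \<bullet> b \<le> c}"
    by (simp_all only: 1 convex_halfspace_le)
qed

text \<open>The intersection of the closed convex hulls of the tails stands in for a weak limit of the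
  subgradients, so that weak compactness of balls is not needed.\<close>

lemma closed_subgradient_pair_dom:
  fixes f :: "'a::{real_inner, complete_space} \<Rightarrow> ereal"
  assumes f: "proper_fun f" "lsc_fun f"
    and C: "closed C" "convex C" "bounded C"
  shows "closed (subgradient_pair_dom f C)"
  unfolding closed_sequential_limits
proof (intro allI impI, elim conjE)
  fix xs x assume xs: "\<forall>n. xs n \<in> subgradient_pair_dom f C" and lim: "xs \<longlonglongrightarrow> x"
  obtain p where p: "\<And>n. p n \<in> C" "\<And>n. fst (p n) \<in> subdifferential f (xs n)"
    "\<And>n. snd (p n) \<in> subdifferential f (xs n)"
  proof -
    have "\<exists>p. p \<in> C \<and> fst p \<in> subdifferential f (xs n) \<and> snd p \<in> subdifferential f (xs n)" for n
      using xs[rule_format, of n] by (auto simp: subgradient_pair_dom_def)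
    then show ?thesis using that by metis
  qed
  define K where "K n = closure (convex hull (p ` {n..}))" for n
  have K_sub: "K n \<subseteq> S" if "closed S" "convex S" "\<And>k. k \<ge> n \<Longrightarrow> p k \<in> S" for n S
    unfolding K_def using that by (intro closure_minimal hull_minimal) auto
  have "(\<Inter>n. K n) \<noteq> {}"
  proof (rule nested_closed_convex_Inter_nonempty)
    show "bounded (K 0)"
      using K_sub[OF C(1,2), of 0] p(1) bounded_subset[OF C(3)] by auto
    show "decseq K"
      unfolding decseq_def K_def by (auto intro!: closure_mono hull_mono image_mono)
  qed (auto simp: K_def)
  then obtain r where r: "\<And>n. r \<in> K n" by blast
  have rC: "r \<in> C" using K_sub[OF C(1,2), of 0] p(1) r by auto
  obtain M where M: "\<And>q. q \<in> C \<Longrightarrow> norm q \<le> M" using C(3) by (auto simp: bounded_iff)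
  \<comment> \<open>\<open>h\<close> will be \<open>fst\<close> or \<open>snd\<close>. Only
    half-spaces in the chosen component are needed, so both members of the pair are treated at
    once.\<close>
  have key: "h r \<in> subdifferential f x"
    if h: "\<And>a c. closed {p. h p \<bullet> a \<le> c}" "\<And>a c. convex {p. h p \<bullet> a \<le> c}"
      and hp: "\<And>n. h (p n) \<in> subdifferential f (xs n)" and hM: "\<And>q. norm (h q) \<le> norm q"
    for h :: "'a \<times> 'a \<Rightarrow> 'a"
  proof -
    have "f x + ereal (h r \<bullet> (z - x)) \<le> f z" for z
    proof (cases "f z = \<infinity>")
      case False
      then obtain b where b: "f z = ereal b"
        using f by (cases "f z") (auto simp: proper_fun_def)
      \<comment> \<open>\<open>f x\<close> is not yet known to be finite, so a real \<open>c\<close>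
        strictly below it takes its place; lower semicontinuity keeps \<open>f (xs n)\<close> above
        \<open>c\<close> for large \<open>n\<close>.\<close>
      have *: "c + h r \<bullet> (z - x) \<le> b" if c: "ereal c < f x" for c
      proof (rule field_le_epsilon)
        fix e :: real assume "e > 0"
        have "\<forall>\<^sub>F n in sequentially. xs n \<in> {z. ereal c < f z}"
          by (rule topological_tendstoD[OF lim lsc_fun_open[OF f(2)]]) (use c in simp)
        moreover have "(\<lambda>n. M * norm (x - xs n)) \<longlonglongrightarrow> M * norm (x - x)"
          by (intro tendsto_intros lim)
        then have "(\<lambda>n. M * norm (x - xs n)) \<longlonglongrightarrow> 0" by simp
        then have "\<forall>\<^sub>F n in sequentially. M * norm (x - xs n) < e"
          using \<open>e > 0\<close> by (rule order_tendstoD)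
        ultimately have "\<forall>\<^sub>F n in sequentially. ereal c < f (xs n) \<and> M * norm (x - xs n) < e"
          by eventually_elim auto
        then obtain N where N: "\<And>n. n \<ge> N \<Longrightarrow> ereal c < f (xs n) \<and> M * norm (x - xs n) < e"
          by (auto simp: eventually_sequentially)
        \<comment> \<open>A closed half-space that contains a tail of the pairs contains
          \<open>K N\<close>, hence \<open>r\<close>. The slack \<open>e\<close> absorbs the error
          of replacing \<open>xs k\<close> by \<open>x\<close>.\<close>
        have "K N \<subseteq> {p. h p \<bullet> (z - x) \<le> b - c + e}"
        proof (rule K_sub[OF h])
          fix k assume k: "N \<le> k"
          have "f (xs k) + ereal (h (p k) \<bullet> (z - xs k)) \<le> ereal b"
            using hp[of k] by (auto simp: subdifferential_def b[symmetric])
          then have "c + h (p k) \<bullet> (z - xs k) \<le> b"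
            using N[OF k] by (cases "f (xs k)") auto
          moreover have "h (p k) \<bullet> (xs k - x) \<le> norm (h (p k)) * norm (xs k - x)"
            by (rule norm_cauchy_schwarz)
          moreover have "\<dots> \<le> M * norm (x - xs k)"
            using hM[of "p k"] M[OF p(1)[of k]] by (simp add: norm_minus_commute mult_right_mono)
          ultimately show "p k \<in> {p. h p \<bullet> (z - x) \<le> b - c + e}"
            using N[OF k] by (simp add: inner_diff_right)
        qed
        then show "c + h r \<bullet> (z - x) \<le> b + e" using r[of N] by auto
      qed
      have "f x \<le> ereal (b - h r \<bullet> (z - x))"
      proof (rule ccontr)
        assume "\<not> f x \<le> ereal (b - h r \<bullet> (z - x))"
        then obtain c where "ereal (b - h r \<bullet> (z - x)) < ereal c" "ereal c < f x"
          using ereal_dense2[of "ereal (b - h r \<bullet> (z - x))" "f x"] by (auto simp: not_le)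
        then show False using *[of c] by simp
      qed
      then show ?thesis by (cases "f x") (auto simp: b)
    qed auto
    then show ?thesis by (simp add: subdifferential_def)
  qed
  have "fst r \<in> subdifferential f x"
    by (rule key[OF closed_halfspace_pair(1,3) p(2)]) (simp add: norm_Pair norm_prod_def)
  moreover have "snd r \<in> subdifferential f x"
    by (rule key[OF closed_halfspace_pair(2,4) p(3)]) (simp add: norm_prod_def)
  ultimately show "x \<in> subgradient_pair_dom f C"
    using rC unfolding subgradient_pair_dom_def by (metis (mono_tags, lifting) mem_Collect_eq prod.collapse)
qed

lemma subgradient_pair_dom_borel:
  fixes f :: "'a::{real_inner, complete_space} \<Rightarrow> ereal"
  assumes "proper_lsc_convex f" "closed C" "convex C" "bounded C"
  shows "subgradient_pair_dom f C \<in> sets borel"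
  using assms by (intro borel_closed closed_subgradient_pair_dom) (auto simp: proper_lsc_convex_def)

subsection \<open>Points with several subgradients\<close>

text \<open>McShane's extension, an infimum of cones of slope \<open>L\<close> with vertices at the
  prescribed values. Indexing by \<open>i\<close> avoids choosing preimages under \<open>p\<close>:
  the hypothesis for both orders of \<open>i\<close> and \<open>j\<close> already makes
  \<open>t i\<close> depend on \<open>p i\<close> only.\<close>

lemma Lipschitz_extension_along:
  fixes p :: "'i \<Rightarrow> 'a::metric_space" and t :: "'i \<Rightarrow> real"
  assumes "\<And>i j. i \<in> A \<Longrightarrow> j \<in> A \<Longrightarrow> t i - t j \<le> L * dist (p i) (p j)" and L: "L \<ge> 0"
  obtains \<tau> where "L-lipschitz_on UNIV \<tau>" "\<And>i. i \<in> A \<Longrightarrow> \<tau> (p i) = t i"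
proof (cases "A = {}")
  case True
  have "L-lipschitz_on UNIV (\<lambda>x::'a. 0::real)" by (rule lipschitz_onI) (use L in auto)
  then show ?thesis using that True by blast
next
  case False
  define \<tau> where "\<tau> x = (INF i\<in>A. t i + L * dist x (p i))" for x
  obtain i0 where i0: "i0 \<in> A" using False by blast
  have bdd: "bdd_below ((\<lambda>i. t i + L * dist x (p i)) ` A)" for x
  proof (rule bdd_belowI2)
    fix i assume "i \<in> A"
    then have "t i0 - t i \<le> L * dist (p i0) (p i)" using assms i0 by blast
    also have "\<dots> \<le> L * (dist x (p i0) + dist x (p i))"
      by (intro mult_left_mono L) (simp add: dist_triangle3)
    finally show "t i0 - L * dist x (p i0) \<le> t i + L * dist x (p i)"
      by (simp add: algebra_simps)
  qed
  have le: "\<tau> x \<le> \<tau> y + L * dist x y" for x y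
  proof -
    have "\<tau> x - L * dist x y \<le> \<tau> y"
      unfolding \<tau>_def[of y]
    proof (rule cINF_greatest[OF False])
      fix i assume "i \<in> A"
      then have "\<tau> x \<le> t i + L * dist x (p i)"
        unfolding \<tau>_def by (rule cINF_lower[OF bdd])
      also have "\<dots> \<le> t i + L * (dist x y + dist y (p i))"
        by (intro add_left_mono mult_left_mono dist_triangle L)
      finally show "\<tau> x - L * dist x y \<le> t i + L * dist y (p i)"
        by (simp add: algebra_simps)
    qed
    then show ?thesis by simp
  qed
  have "L-lipschitz_on UNIV \<tau>"
  proof (rule lipschitz_onI[OF _ L])
    fix x y show "dist (\<tau> x) (\<tau> y) \<le> L * dist x y"
      using le[of x y] le[of y x] by (auto simp: dist_real_def abs_le_iff dist_commute)
  qed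
  moreover have "\<tau> (p i) = t i" if "i \<in> A" for i
  proof (rule antisym)
    show "\<tau> (p i) \<le> t i" unfolding \<tau>_def by (rule cINF_lower2[OF bdd that]) simp
    show "t i \<le> \<tau> (p i)"
      unfolding \<tau>_def
      by (rule cINF_greatest[OF False]) (use assms that in \<open>force simp: algebra_simps\<close>)
  qed
  ultimately show ?thesis using that by blast
qed

text \<open>The hypersurface is the set of fixed points of a continuous map: project orthogonally to
  \<open>v\<close>, then lift by \<open>\<tau>\<close>. Being closed it is Borel, so its measure 0
  makes it a genuine null set.\<close>

lemma lipschitz_hypersurface_closed:
  fixes S :: "'a::real_inner set"
  assumes "lipschitz_hypersurface S" shows "closed S"
proof -
  obtain v L \<tau> where v: "v \<noteq> 0" and \<tau>: "L-lipschitz_on UNIV (\<tau> :: 'a \<Rightarrow> real)"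
    and S: "S = {z + \<tau> z *\<^sub>R v | z. z \<in> {c *\<^sub>R v | c. c \<in> UNIV}\<^sup>\<bottom>}"
    using assms unfolding lipschitz_hypersurface_def by blast
  define q where "q x = x - ((x \<bullet> v) / (v \<bullet> v)) *\<^sub>R v" for x
  have orth: "z \<in> {c *\<^sub>R v | c. c \<in> UNIV}\<^sup>\<bottom> \<longleftrightarrow> v \<bullet> z = 0" for z
    using inner_scaleR_left[of 1] by (force simp: orthogonal_comp_def orthogonal_def)
  have S': "S = {z + \<tau> z *\<^sub>R v | z. v \<bullet> z = 0}" unfolding S orth by (rule refl)
  have "S = {x. q x + \<tau> (q x) *\<^sub>R v = x}"
  proof (intro set_eqI iffI)
    fix x assume "x \<in> S"
    then obtain z where z: "v \<bullet> z = 0" "x = z + \<tau> z *\<^sub>R v"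
      unfolding S' by blast
    then have "x \<bullet> v = \<tau> z * (v \<bullet> v)" by (simp add: inner_add_left inner_commute[of z v])
    then have "q x = z" using v z(2) by (simp add: q_def)
    then show "x \<in> {x. q x + \<tau> (q x) *\<^sub>R v = x}" using z by simp
  next
    fix x assume "x \<in> {x. q x + \<tau> (q x) *\<^sub>R v = x}"
    moreover have "v \<bullet> q x = 0" using v by (simp add: q_def inner_diff_right inner_commute)
    ultimately have "v \<bullet> q x = 0 \<and> x = q x + \<tau> (q x) *\<^sub>R v" by simp
    then show "x \<in> S" unfolding S' by blast
  qed
  moreover have q: "continuous_on UNIV q"
    unfolding q_def by (intro continuous_intros) (use v in auto)
  moreover have "continuous_on UNIV (\<lambda>x. \<tau> (q x))"
    by (rule continuous_on_compose2[OF lipschitz_on_continuous_on[OF \<tau>] q]) auto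
  ultimately show ?thesis
    by (simp add: closed_Collect_eq continuous_on_add continuous_on_scaleR continuous_on_const continuous_on_id)
qed

text \<open>A quantitative form of having two different subgradients: the gap between
  \<open>p\<close> and \<open>q\<close> and the norm bound \<open>m\<close> together determine the
  Lipschitz constant, and \<open>m\<close> also gives boundedness.\<close>

definition separated_pairs :: "'a::real_inner \<Rightarrow> real \<Rightarrow> real \<Rightarrow> real \<Rightarrow> ('a \<times> 'a) set" where
  "separated_pairs v p q m =
     {(y, y'). norm y \<le> m \<and> norm y' \<le> m \<and> y \<bullet> v \<le> p \<and> q \<le> y' \<bullet> v}"

lemma separated_pairs_closed_convex_bounded:
  fixes v :: "'a::real_inner"
  shows "closed (separated_pairs v p q m)" "convex (separated_pairs v p q m)"
    "bounded (separated_pairs v p q m)"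
proof -
  have eq: "separated_pairs v p q m =
      (cball 0 m \<times> cball 0 m) \<inter> {z. fst z \<bullet> v \<le> p} \<inter> {z. snd z \<bullet> (- v) \<le> - q}"
    by (auto simp: separated_pairs_def)
  show "closed (separated_pairs v p q m)"
    unfolding eq by (intro closed_Int closed_Times closed_halfspace_pair closed_cball)
  show "convex (separated_pairs v p q m)"
    unfolding eq by (intro convex_Int convex_Times closed_halfspace_pair convex_cball)
  show "bounded (separated_pairs v p q m)"
    unfolding eq by (intro bounded_Int disjI1 bounded_Times bounded_cball)
qed

text \<open>Monotonicity, applied to the subgradient with large \<open>v\<close>-component at the lower point and the one
  with small \<open>v\<close>-component at the upper point, bounds the height difference by the horizontal distance.\<close>

lemma subgradient_pair_dom_in_hypersurface:
  fixes f :: "'a::real_inner \<Rightarrow> ereal"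
  assumes f: "proper_fun f" and v: "v \<noteq> 0" and pq: "p < q"
  obtains S where "lipschitz_hypersurface S"
    "subgradient_pair_dom f (separated_pairs v p q m) \<subseteq> S"
proof -
  let ?A = "subgradient_pair_dom f (separated_pairs v p q m)"
  \<comment> \<open>Coordinates adapted to \<open>v\<close>: every \<open>x\<close> is
    \<open>w x + t x *\<^sub>R v\<close> with \<open>w x\<close> orthogonal to
    \<open>v\<close>.\<close>
  define t where "t x = (x \<bullet> v) / (v \<bullet> v)" for x
  define w where "w x = x - t x *\<^sub>R v" for x
  \<comment> \<open>Two subgradients of norm at most \<open>m\<close> differ by at most
    \<open>2 * m\<close>, and the gap \<open>q - p\<close> is divided out. The absolute value keeps
    \<open>L\<close> nonnegative for negative \<open>m\<close>, where the set of pairs is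
    empty.\<close>
  define L where "L = 2 * \<bar>m\<bar> / (q - p)"
  have L: "L \<ge> 0" using pq by (simp add: L_def)
  have "t x - t x' \<le> L * dist (w x) (w x')" if x: "x \<in> ?A" and x': "x' \<in> ?A" for x x'
  proof (cases "t x \<le> t x'")
    case True
    then show ?thesis using L by (smt (verit) mult_nonneg_nonneg zero_le_dist)
  next
    case False
    define s where "s = t x - t x'"
    have s: "s > 0" using False by (simp add: s_def)
    obtain y where y: "y \<in> subdifferential f x" "y \<bullet> v \<le> p" "norm y \<le> m"
      using x by (auto simp: subgradient_pair_dom_def separated_pairs_def)
    obtain y' where y': "y' \<in> subdifferential f x'" "q \<le> y' \<bullet> v" "norm y' \<le> m"
      using x' by (auto simp: subgradient_pair_dom_def separated_pairs_def)
    have diff: "x - x' = (w x - w x') + s *\<^sub>R v" by (simp add: w_def s_def algebra_simps)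
    have "0 \<le> (y - y') \<bullet> (x - x')" by (rule subdifferential_monotone[OF f y(1) y'(1)])
    also have "\<dots> = (y - y') \<bullet> (w x - w x') + s * ((y - y') \<bullet> v)"
      unfolding diff by (simp add: inner_add_right)
    also have "\<dots> \<le> (y - y') \<bullet> (w x - w x') + s * (p - q)"
      using y y' s by (intro add_left_mono mult_left_mono) (auto simp: inner_diff_left)
    finally have "s * (q - p) \<le> (y - y') \<bullet> (w x - w x')" by (simp add: algebra_simps)
    also have "\<dots> \<le> norm (y - y') * norm (w x - w x')" by (rule norm_cauchy_schwarz)
    also have "\<dots> \<le> (2 * \<bar>m\<bar>) * norm (w x - w x')"
      using norm_triangle_ineq4[of y y'] y(3) y'(3) by (intro mult_right_mono) auto
    finally have "s \<le> L * dist (w x) (w x')"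
      using pq by (simp add: L_def dist_norm pos_le_divide_eq)
    then show ?thesis by (simp add: s_def)
  qed
  then obtain \<tau> where \<tau>: "L-lipschitz_on UNIV \<tau>" "\<And>x. x \<in> ?A \<Longrightarrow> \<tau> (w x) = t x"
    using Lipschitz_extension_along[of ?A t L w] L by blast
  let ?S = "{z + \<tau> z *\<^sub>R v | z. z \<in> {c *\<^sub>R v | c. c \<in> UNIV}\<^sup>\<bottom>}"
  have "lipschitz_hypersurface ?S"
    using v \<tau>(1) by (auto simp: lipschitz_hypersurface_def)
  moreover have "subgradient_pair_dom f (separated_pairs v p q m) \<subseteq> ?S"
  proof
    fix x assume "x \<in> subgradient_pair_dom f (separated_pairs v p q m)"
    then have "x = w x + \<tau> (w x) *\<^sub>R v" using \<tau>(2) by (simp add: w_def)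
    moreover have "w x \<in> {c *\<^sub>R v | c. c \<in> UNIV}\<^sup>\<bottom>"
      using v by (auto simp: orthogonal_comp_def orthogonal_def w_def t_def inner_diff_right inner_commute)
    ultimately show "x \<in> ?S" by blast
  qed
  ultimately show ?thesis using that by blast
qed

text \<open>A sequence, fixed once, rather than a countable dense set: its indices enumerate
  directions and balls, and \<open>nearest_point\<close> recurs on them.\<close>

definition dense_sequence :: "nat \<Rightarrow> 'a::second_countable_topology" where
  "dense_sequence = (SOME d. \<forall>U. open U \<longrightarrow> U \<noteq> {} \<longrightarrow> (\<exists>n. d n \<in> U))"

lemma dense_sequence:
  fixes U :: "'a::second_countable_topology set"
  assumes "open U" "U \<noteq> {}" shows "\<exists>n. dense_sequence n \<in> U"
proof -
  obtain D :: "'a set" where D: "countable D" "\<And>X. open X \<Longrightarrow> X \<noteq> {} \<Longrightarrow> \<exists>d\<in>D. d \<in> X"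
    by (rule countable_dense_setE) blast
  have "D \<noteq> {}" using D(2)[of UNIV] by auto
  then have "range (from_nat_into D) = D" using D(1) by (rule range_from_nat_into)
  then have "\<exists>n. from_nat_into D n \<in> U" if "open U" "U \<noteq> {}" for U
    using D(2)[OF that] by (metis imageE)
  then have "\<exists>d::nat \<Rightarrow> 'a. \<forall>U. open U \<longrightarrow> U \<noteq> {} \<longrightarrow> (\<exists>n. d n \<in> U)"
    by blast
  then have "\<forall>U. open U \<longrightarrow> U \<noteq> {} \<longrightarrow> (\<exists>n. (dense_sequence :: nat \<Rightarrow> 'a) n \<in> U)"
    unfolding dense_sequence_def by (rule someI_ex)
  then show ?thesis using assms by blast
qed

definition multi_dom :: "('a::real_inner \<Rightarrow> ereal) \<Rightarrow> 'a set" where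
  "multi_dom f = {x. \<exists>y y'. y \<in> subdifferential f x \<and> y' \<in> subdifferential f x \<and> y \<noteq> y'}"

lemma dom_grad_eq: "dom_grad f = {x. subdifferential f x \<noteq> {}} - multi_dom f"
proof (intro set_eqI iffI)
  fix x assume "x \<in> dom_grad f"
  then obtain y where "subdifferential f x = {y}" unfolding dom_grad_def is_singleton_def by blast
  then show "x \<in> {x. subdifferential f x \<noteq> {}} - multi_dom f" by (simp add: multi_dom_def)
next
  fix x assume "x \<in> {x. subdifferential f x \<noteq> {}} - multi_dom f"
  then have "subdifferential f x \<noteq> {}"
    "\<And>y y'. y \<in> subdifferential f x \<Longrightarrow> y' \<in> subdifferential f x \<Longrightarrow> y = y'"
    unfolding multi_dom_def by blast+
  then show "x \<in> dom_grad f" unfolding dom_grad_def by (blast intro: is_singletonI')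
qed

lemma subdifferential_dom_grad:
  assumes "x \<in> dom_grad f" shows "subdifferential f x = {grad f x}"
proof -
  obtain y where "subdifferential f x = {y}"
    using assms unfolding dom_grad_def is_singleton_def by blast
  then show ?thesis by (simp add: grad_def)
qed

lemma grad_eqI: "x \<in> dom_grad f \<Longrightarrow> y \<in> subdifferential f x \<Longrightarrow> grad f x = y"
  using subdifferential_dom_grad by fastforce

text \<open>For \<open>y \<noteq> y'\<close> the vectors with positive inner product with
  \<open>y' - y\<close> form a nonempty open set, so some member of the dense sequence separates the
  two; rational levels and an integer norm bound then fit in between. This makes the union
  countable.\<close>

lemma multi_dom_eq:
  fixes f :: "'a::{real_inner, second_countable_topology} \<Rightarrow> ereal"
  shows "multi_dom f = (\<Union>(i, p, q, m) \<in> {(i, p, q, m). p < q \<and> (dense_sequence i :: 'a) \<noteq> 0}.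
     subgradient_pair_dom f
       (separated_pairs (dense_sequence i) (real_of_rat p) (real_of_rat q) (real (m::nat))))"
    (is "_ = (\<Union>(i, p, q, m) \<in> ?I. ?S i p q m)")
proof (intro set_eqI iffI)
  fix x assume "x \<in> multi_dom f"
  then obtain y y' where y: "y \<in> subdifferential f x" "y' \<in> subdifferential f x" "y \<noteq> y'"
    by (auto simp: multi_dom_def)
  let ?U = "{v. (y' - y) \<bullet> v > 0}"
  have "open ?U" by (rule open_halfspace_gt)
  moreover have "y' - y \<in> ?U" using y(3) by simp
  ultimately obtain i where i: "(y' - y) \<bullet> dense_sequence i > 0"
    using dense_sequence[of ?U] by blast
  let ?v = "dense_sequence i :: 'a"
  have "y \<bullet> ?v < y' \<bullet> ?v" using i by (simp add: inner_diff_left)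
  then obtain p where p: "y \<bullet> ?v < real_of_rat p" "real_of_rat p < y' \<bullet> ?v"
    using of_rat_dense by blast
  obtain q where q: "real_of_rat p < real_of_rat q" "real_of_rat q < y' \<bullet> ?v"
    using of_rat_dense[OF p(2)] by blast
  obtain m :: nat where m: "max (norm y) (norm y') \<le> real m" using real_arch_simple by blast
  have "x \<in> ?S i p q m"
    unfolding subgradient_pair_dom_def separated_pairs_def
    by (intro CollectI exI[of _ y] exI[of _ y']) (use y p q m in auto)
  moreover have "(i, p, q, m) \<in> ?I" using q i by (auto simp: of_rat_less)
  ultimately show "x \<in> (\<Union>(i, p, q, m) \<in> ?I. ?S i p q m)" by blast
next
  fix x assume "x \<in> (\<Union>(i, p, q, m) \<in> ?I. ?S i p q m)"
  then obtain i p q m where "p < q" "x \<in> ?S i p q m" by auto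
  then obtain y y' where "y \<in> subdifferential f x" "y' \<in> subdifferential f x"
    "y \<bullet> dense_sequence i \<le> real_of_rat p" "real_of_rat q \<le> y' \<bullet> dense_sequence i"
    "real_of_rat p < real_of_rat q"
    by (auto simp: subgradient_pair_dom_def separated_pairs_def of_rat_less)
  then have "y \<noteq> y'" by auto
  then show "x \<in> multi_dom f" unfolding multi_dom_def using \<open>y \<in> _\<close> \<open>y' \<in> _\<close> by blast
qed

section \<open>Borel measurability of the domain of the gradient and of the gradient\<close>

lemma multi_dom_borel:
  fixes f :: "'a::{real_inner, polish_space} \<Rightarrow> ereal"
  assumes "proper_lsc_convex f" shows "multi_dom f \<in> sets borel"
proof -
  have "subgradient_pair_dom f (separated_pairs v p q m) \<in> sets borel" for v :: 'a and p q m
    by (intro subgradient_pair_dom_borel assms separated_pairs_closed_convex_bounded)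
  then show ?thesis
    unfolding multi_dom_eq by (intro sets.countable_UN' countableI_type) auto
qed

lemma subdifferential_dom_borel:
  fixes f :: "'a::{real_inner, polish_space} \<Rightarrow> ereal"
  assumes "proper_lsc_convex f" shows "{x. subdifferential f x \<noteq> {}} \<in> sets borel"
proof -
  have "{x. subdifferential f x \<noteq> {}} =
      (\<Union>n. subgradient_pair_dom f (cball 0 (real n) \<times> cball 0 (real n)))"
  proof (intro set_eqI iffI)
    fix x assume "x \<in> {x. subdifferential f x \<noteq> {}}"
    then obtain y where y: "y \<in> subdifferential f x" by blast
    obtain n where n: "norm y \<le> real n" using real_arch_simple by blast
    have "x \<in> subgradient_pair_dom f (cball 0 (real n) \<times> cball 0 (real n))"
      unfolding subgradient_pair_dom_def
      by (intro CollectI exI[of _ y]) (use y n in auto)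
    then show "x \<in> (\<Union>n. subgradient_pair_dom f (cball 0 (real n) \<times> cball 0 (real n)))" by blast
  qed (auto simp: subgradient_pair_dom_def)
  moreover have "subgradient_pair_dom f (cball 0 (real n) \<times> cball 0 (real n)) \<in> sets borel" for n
    by (intro subgradient_pair_dom_borel assms closed_Times convex_Times bounded_Times) auto
  ultimately show ?thesis by auto
qed

lemma dom_grad_borel:
  fixes f :: "'a::{real_inner, polish_space} \<Rightarrow> ereal"
  assumes "proper_lsc_convex f" shows "dom_grad f \<in> sets borel"
  unfolding dom_grad_eq using assms by (intro sets.Diff subdifferential_dom_borel multi_dom_borel)

text \<open>Closed balls are needed because closedness of \<open>subgradient_pair_dom\<close> is
  available only for closed bounded convex sets of pairs.\<close>

lemma open_eq_Union_cball:
  fixes U :: "'a::{metric_space, second_countable_topology} set"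
  assumes "open U"
  shows "U = (\<Union>(i, n)\<in>{(i, n). cball (dense_sequence i) (1 / real (Suc n)) \<subseteq> U}.
    cball (dense_sequence i) (1 / real (Suc n)))"
proof (intro set_eqI iffI)
  fix x assume "x \<in> U"
  then obtain e where e: "e > 0" "ball x e \<subseteq> U" using assms open_contains_ball by blast
  obtain n where n: "1 / real (Suc n) < e / 2"
    using e(1) nat_approx_posE[of "e / 2"] half_gt_zero by metis
  obtain i where i: "(dense_sequence i :: 'a) \<in> ball x (1 / real (Suc n))"
    using dense_sequence[of "ball x (1 / real (Suc n))"] ball_eq_empty[of x "1 / real (Suc n)"]
    by (metis not_le of_nat_0_less_iff open_ball zero_less_Suc zero_less_divide_1_iff)
  have "cball (dense_sequence i :: 'a) (1 / real (Suc n)) \<subseteq> ball x e"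
  proof
    fix z assume "z \<in> cball (dense_sequence i :: 'a) (1 / real (Suc n))"
    then have "dist (dense_sequence i) z \<le> 1 / real (Suc n)" by (simp only: mem_cball)
    moreover have "dist x (dense_sequence i) < 1 / real (Suc n)" using i by (simp only: mem_ball)
    ultimately have "dist x z < e"
      using n dist_triangle[of x z "dense_sequence i :: 'a"] by linarith
    then show "z \<in> ball x e" by simp
  qed
  moreover have "x \<in> cball (dense_sequence i) (1 / real (Suc n))"
    using i by (simp add: dist_commute)
  ultimately show "x \<in> (\<Union>(i, n)\<in>{(i, n). cball (dense_sequence i) (1 / real (Suc n)) \<subseteq> U}.
    cball (dense_sequence i) (1 / real (Suc n)))"
    using e(2) by (intro UN_I[of "(i, n)"]) (simp_all only: mem_Collect_eq prod.case subset_trans)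
qed (auto simp del: mem_cball)

text \<open>On \<open>dom_grad f\<close> both members of a pair of subgradients are the gradient, so
  there the preimage of a closed ball is cut out by a closed set. Countably many such balls exhaust
  an open set.\<close>

lemma grad_measurable:
  fixes f :: "'a::{real_inner, polish_space} \<Rightarrow> ereal"
  assumes f: "proper_lsc_convex f"
  shows "grad f \<in> borel_measurable (restrict_space borel (dom_grad f))"
proof (rule borel_measurableI)
  fix U :: "'a set" assume "open U"
  let ?I = "{(i, n). cball (dense_sequence i) (1 / real (Suc n)) \<subseteq> U}"
  let ?C = "\<lambda>i n. cball (dense_sequence i :: 'a) (1 / real (Suc n))"
  have "grad f x \<in> U \<longleftrightarrow> (\<exists>i n. ?C i n \<subseteq> U \<and> grad f x \<in> ?C i n)" for x
    by (subst (1) open_eq_Union_cball[OF \<open>open U\<close>]) (auto simp del: mem_cball)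
  then have "grad f -` U \<inter> dom_grad f = dom_grad f \<inter>
      (\<Union>(i, n)\<in>?I. subgradient_pair_dom f (?C i n \<times> ?C i n))"
    by (auto simp: subgradient_pair_dom_def subdifferential_dom_grad simp del: mem_cball)
  moreover have "(\<Union>(i, n)\<in>?I. subgradient_pair_dom f (?C i n \<times> ?C i n)) \<in> sets borel"
  proof (rule sets.countable_UN')
    show "countable ?I" by (rule countableI_type)
    have "subgradient_pair_dom f (?C i n \<times> ?C i n) \<in> sets borel" for i n
      by (intro subgradient_pair_dom_borel f closed_Times convex_Times bounded_Times) auto
    then show "(\<lambda>(i, n). subgradient_pair_dom f (?C i n \<times> ?C i n)) ` ?I \<subseteq> sets borel" by auto
  qed
  ultimately show "grad f -` U \<inter> space (restrict_space borel (dom_grad f))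
      \<in> sets (restrict_space borel (dom_grad f))"
    using dom_grad_borel[OF f] by (auto simp: sets_restrict_space space_restrict_space)
qed

lemma multi_dom_null:
  fixes P :: "'a::{real_inner, polish_space} measure"
  assumes P: "P \<in> lipschitz_null_measures" and f: "proper_lsc_convex f"
  shows "multi_dom f \<in> null_sets P"
  unfolding multi_dom_eq
proof (rule null_sets_UN')
  show "countable {(i, p, q, m :: nat). (p::rat) < q \<and> dense_sequence i \<noteq> (0::'a)}"
    by (rule countableI_type)
  fix z assume "z \<in> {(i, p, q, m :: nat). (p::rat) < q \<and> dense_sequence i \<noteq> (0::'a)}"
  then obtain i p q m where z: "z = (i, p, q, m)"
    and pq: "real_of_rat p < real_of_rat q" and v: "dense_sequence i \<noteq> (0::'a)"
    by (cases z) (auto simp: of_rat_less)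
  let ?A = "subgradient_pair_dom f (separated_pairs (dense_sequence i) (real_of_rat p) (real_of_rat q) (real m))"
  obtain S where S: "lipschitz_hypersurface S" "?A \<subseteq> S"
    using subgradient_pair_dom_in_hypersurface[OF _ v pq] f by (auto simp: proper_lsc_convex_def)
  have sets: "sets P = sets borel" using P by (auto simp: lipschitz_null_measures_def borel_prob_measures_def)
  have "S \<in> null_sets P"
    using P S(1) lipschitz_hypersurface_closed[OF S(1)]
    by (auto simp: null_sets_def sets lipschitz_null_measures_def)
  moreover have "?A \<in> sets P"
    unfolding sets by (intro subgradient_pair_dom_borel f separated_pairs_closed_convex_bounded)
  ultimately have "?A \<in> null_sets P"
    using S(2) by (meson null_sets_subset)
  then show "(case z of (i, p, q, m) \<Rightarrow> subgradient_pair_dom f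
      (separated_pairs (dense_sequence i) (real_of_rat p) (real_of_rat q) (real m))) \<in> null_sets P"
    by (simp add: z)
qed

subsection \<open>Optimal couplings of finite distributions\<close>

text \<open>The cycle is closed by an extra entry \<open>x (Suc n)\<close> instead of indices modulo
  its length. The sum is the change in total correlation when each \<open>y i\<close> is re-paired
  with the next point \<open>x (Suc i)\<close>.\<close>

definition cyclically_monotone :: "('a::real_inner \<times> 'a) set \<Rightarrow> bool" where
  "cyclically_monotone \<Gamma> \<longleftrightarrow> (\<forall>n x y. x (Suc n) = x 0 \<longrightarrow> (\<forall>i\<le>n. (x i, y i) \<in> \<Gamma>) \<longrightarrow>
     (\<Sum>i\<le>n. y i \<bullet> (x (Suc i) - x i)) \<le> 0)"

text \<open>Tychonoff's theorem, carried over from the explicit product topology to the type class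
  topology on functions.\<close>

lemma compact_PiE_UNIV:
  fixes K :: "'i \<Rightarrow> 'a::topological_space set"
  assumes "\<And>i. compact (K i)" shows "compact (Pi\<^sub>E UNIV K)"
proof -
  have "compactin (product_topology (\<lambda>i. euclidean) UNIV) (Pi\<^sub>E UNIV K)"
    using assms by (simp add: compactin_PiE)
  then show ?thesis by (simp add: euclidean_product_topology)
qed

text \<open>The couplings form a nonempty compact set, so total correlation has a maximiser; with
  fixed marginals this amounts to minimising the quadratic cost. A cycle of positive sum in its
  support would allow mass to be moved from each \<open>(x i, y i)\<close> to
  \<open>(x (Suc i), y i)\<close>, keeping the marginals and raising the correlation.\<close>

lemma finite_optimal_coupling:
  fixes A B :: "'a::real_inner set" and p q :: "'a \<Rightarrow> real"
  assumes fin: "finite A" "finite B"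
    and p: "\<And>a. a \<in> A \<Longrightarrow> 0 \<le> p a" "sum p A = 1"
    and q: "\<And>b. b \<in> B \<Longrightarrow> 0 \<le> q b" "sum q B = 1"
  obtains g :: "'a \<times> 'a \<Rightarrow> real" where "\<And>z. 0 \<le> g z" "\<And>z. z \<notin> A \<times> B \<Longrightarrow> g z = 0"
    "\<And>a. a \<in> A \<Longrightarrow> (\<Sum>b\<in>B. g (a, b)) = p a" "\<And>b. b \<in> B \<Longrightarrow> (\<Sum>a\<in>A. g (a, b)) = q b"
    "cyclically_monotone {z. g z > 0}"
proof -
  \<comment> \<open>Values off \<open>A \<times> B\<close> are pinned to 0, so that couplings live
    in a compact product over the whole type. The bound 1 follows from the marginals, as
    \<open>CI\<close> shows.\<close>
  define K where "K z = (if z \<in> A \<times> B then {0..1::real} else {0})" for z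
  define C where "C = Pi\<^sub>E UNIV K \<inter> {g. \<forall>a\<in>A. (\<Sum>b\<in>B. g (a, b)) = p a} \<inter> {g. \<forall>b\<in>B. (\<Sum>a\<in>A. g (a, b)) = q b}"
  define J where "J g = (\<Sum>z\<in>A\<times>B. g z * (fst z \<bullet> snd z))" for g :: "'a \<times> 'a \<Rightarrow> real"
  have CI: "g \<in> C" if g0: "\<And>z. 0 \<le> g z" and gz: "\<And>z. z \<notin> A \<times> B \<Longrightarrow> g z = 0"
    and gp: "\<And>a. a \<in> A \<Longrightarrow> (\<Sum>b\<in>B. g (a, b)) = p a" and gq: "\<And>b. b \<in> B \<Longrightarrow> (\<Sum>a\<in>A. g (a, b)) = q b" for g
  proof -
    have "g (a, b) \<le> 1" if "a \<in> A" "b \<in> B" for a b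
    proof -
      have "g (a, b) \<le> (\<Sum>b\<in>B. g (a, b))" by (rule member_le_sum) (use that fin g0 in auto)
      also have "\<dots> = p a" by (rule gp) fact
      also have "\<dots> \<le> sum p A" by (rule member_le_sum) (use that fin p in auto)
      finally show ?thesis by (simp add: p)
    qed
    then have "g z \<in> K z" for z
      using g0[of z] gz[of z] by (cases z) (simp add: K_def)
    then show ?thesis unfolding C_def by (simp add: PiE_iff gp gq)
  qed
  have cpt: "compact C"
    unfolding C_def Ball_def
  proof (intro compact_Int_closed compact_PiE_UNIV closed_Collect_all)
    show "compact (K z)" for z by (simp add: K_def)
    show "closed {g. a \<in> A \<longrightarrow> (\<Sum>b\<in>B. g (a, b)) = p a}" for a
      by (intro closed_Collect_imp open_Collect_const closed_Collect_eq continuous_intros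
          continuous_on_product_coordinates)
    show "closed {g. b \<in> B \<longrightarrow> (\<Sum>a\<in>A. g (a, b)) = q b}" for b
      by (intro closed_Collect_imp open_Collect_const closed_Collect_eq continuous_intros
          continuous_on_product_coordinates)
  qed
  have ne: "C \<noteq> {}"
  proof -
    let ?g = "\<lambda>(a, b). if a \<in> A \<and> b \<in> B then p a * q b else 0"
    have "?g \<in> C"
    proof (rule CI)
      show "0 \<le> ?g z" for z by (cases z) (simp add: p q)
      show "?g z = 0" if "z \<notin> A \<times> B" for z using that by (cases z) auto
      show "(\<Sum>b\<in>B. ?g (a, b)) = p a" if "a \<in> A" for a
      proof -
        have "(\<Sum>b\<in>B. ?g (a, b)) = (\<Sum>b\<in>B. p a * q b)" by (rule sum.cong) (auto simp: that)
        also have "\<dots> = p a" unfolding sum_distrib_left[symmetric] q by simp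
        finally show ?thesis .
      qed
      show "(\<Sum>a\<in>A. ?g (a, b)) = q b" if "b \<in> B" for b
      proof -
        have "(\<Sum>a\<in>A. ?g (a, b)) = (\<Sum>a\<in>A. p a * q b)" by (rule sum.cong) (auto simp: that)
        also have "\<dots> = q b" unfolding sum_distrib_right[symmetric] p by simp
        finally show ?thesis .
      qed
    qed
    then show ?thesis by blast
  qed
  have cont: "continuous_on C J"
  proof (rule continuous_on_subset[of UNIV])
    show "continuous_on UNIV J"
      unfolding J_def by (intro continuous_intros continuous_on_product_coordinates)
  qed auto
  obtain g where gC: "g \<in> C" and gmax: "\<And>h. h \<in> C \<Longrightarrow> J h \<le> J g"
    using continuous_attains_sup[OF cpt ne cont] by blast
  have K: "g z \<in> K z" for z using gC unfolding C_def by (cases z) (simp add: PiE_iff)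
  have g0: "0 \<le> g z" for z using K[of z] by (auto simp: K_def split: if_splits)
  have gz: "g z = 0" if "z \<notin> A \<times> B" for z using K[of z] that by (auto simp: K_def split: if_splits)
  have gp: "(\<Sum>b\<in>B. g (a, b)) = p a" if "a \<in> A" for a using gC that unfolding C_def by blast
  have gq: "(\<Sum>a\<in>A. g (a, b)) = q b" if "b \<in> B" for b using gC that unfolding C_def by blast
  have "cyclically_monotone {z. g z > 0}"
    unfolding cyclically_monotone_def
  proof (intro allI impI)
    fix n and x y :: "nat \<Rightarrow> 'a"
    assume cyc: "x (Suc n) = x 0" and "\<forall>i\<le>n. (x i, y i) \<in> {z. g z > 0}"
    then have pos: "g (x i, y i) > 0" if "i \<le> n" for i using that by auto
    have xA: "x i \<in> A" and yB: "y i \<in> B" if "i \<le> n" for i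
      using pos[OF that] gz[of "(x i, y i)"] by auto
    have xA': "x (Suc i) \<in> A" if "i \<le> n" for i
      using xA[of "Suc i"] xA[of 0] cyc that by (cases "i = n") auto
    \<comment> \<open>A pair may occur up to \<open>Suc n\<close> times in the cycle, and each
      occurrence removes \<open>e\<close> from it; the division keeps the perturbed coupling
      nonnegative.\<close>
    define e where "e = Min ((\<lambda>i. g (x i, y i)) ` {..n}) / real (Suc n)"
    have "Min ((\<lambda>i. g (x i, y i)) ` {..n}) > 0" using pos by (subst Min_gr_iff) auto
    then have e: "e > 0" by (simp add: e_def)
    have e_le: "e * real (Suc n) \<le> g (x i, y i)" if "i \<le> n" for i
      unfolding e_def using that by simp
    define h where "h z = g z + e * (\<Sum>i\<le>n. of_bool (z = (x (Suc i), y i)) - of_bool (z = (x i, y i)))" for z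
    have "h \<in> C"
    proof (rule CI)
      fix z
      show "0 \<le> h z"
      proof (cases "\<exists>j\<le>n. z = (x j, y j)")
        case True
        then obtain j where j: "j \<le> n" "z = (x j, y j)" by blast
        have "- real (Suc n) = (\<Sum>i\<le>n. (-1::real))" by simp
        also have "\<dots> \<le> (\<Sum>i\<le>n. of_bool (z = (x (Suc i), y i)) - of_bool (z = (x i, y i)))"
          by (rule sum_mono) auto
        finally have "e * - real (Suc n) \<le> e * (\<Sum>i\<le>n. of_bool (z = (x (Suc i), y i)) - of_bool (z = (x i, y i)))"
          using e by (intro mult_left_mono) auto
        then have "- (e * real (Suc n)) \<le> h z - g z" by (simp only: h_def mult_minus_right add_diff_cancel_left')
        then show ?thesis using e_le[OF j(1)] unfolding j(2) by linarith
      next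
        case False
        then have "0 \<le> (\<Sum>i\<le>n. of_bool (z = (x (Suc i), y i)) - of_bool (z = (x i, y i)) :: real)"
          by (intro sum_nonneg) auto
        then show ?thesis using e g0[of z] by (simp add: h_def)
      qed
      show "h z = 0" if "z \<notin> A \<times> B"
      proof -
        have "(\<Sum>i\<le>n. of_bool (z = (x (Suc i), y i)) - of_bool (z = (x i, y i)) :: real) = 0"
          using that xA xA' yB by (intro sum.neutral) auto
        then show ?thesis by (simp add: h_def gz that)
      qed
    next
      fix a assume a: "a \<in> A"
      have "(\<Sum>b\<in>B. h (a, b)) = p a + e * (\<Sum>b\<in>B. \<Sum>i\<le>n. of_bool ((a, b) = (x (Suc i), y i)) - of_bool ((a, b) = (x i, y i)))"
        by (simp add: h_def sum.distrib gp[OF a] sum_distrib_left)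
      also have "(\<Sum>b\<in>B. \<Sum>i\<le>n. of_bool ((a, b) = (x (Suc i), y i)) - of_bool ((a, b) = (x i, y i)) :: real) =
          (\<Sum>i\<le>n. \<Sum>b\<in>B. of_bool ((a, b) = (x (Suc i), y i)) - of_bool ((a, b) = (x i, y i)))"
        by (rule sum.swap)
      also have "\<dots> = (\<Sum>i\<le>n. of_bool (a = x (Suc i)) - of_bool (a = x i))"
      proof (rule sum.cong[OF refl])
        fix i assume "i \<in> {..n}"
        have "(\<Sum>b\<in>B. of_bool ((a, b) = (x (Suc i), y i)) - of_bool ((a, b) = (x i, y i)) :: real) =
            (\<Sum>b\<in>B. if b = y i then of_bool (a = x (Suc i)) - of_bool (a = x i) else 0)"
          by (rule sum.cong) auto
        then show "(\<Sum>b\<in>B. of_bool ((a, b) = (x (Suc i), y i)) - of_bool ((a, b) = (x i, y i)) :: real) =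
            of_bool (a = x (Suc i)) - of_bool (a = x i)"
          using yB \<open>i \<in> {..n}\<close> fin by simp
      qed
      \<comment> \<open>In the first marginal the changes telescope around the closed cycle. In the
        second each change vanishes by itself, because \<open>y i\<close> is kept.\<close>
      also have "\<dots> = of_bool (a = x (Suc n)) - of_bool (a = x 0)"
        unfolding lessThan_Suc_atMost[symmetric] by (rule sum_lessThan_telescope)
      also have "\<dots> = 0" by (simp add: cyc)
      finally show "(\<Sum>b\<in>B. h (a, b)) = p a" by simp
    next
      fix b assume b: "b \<in> B"
      have "(\<Sum>a\<in>A. h (a, b)) = q b + e * (\<Sum>a\<in>A. \<Sum>i\<le>n. of_bool ((a, b) = (x (Suc i), y i)) - of_bool ((a, b) = (x i, y i)))"
        by (simp add: h_def sum.distrib gq[OF b] sum_distrib_left)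
      also have "(\<Sum>a\<in>A. \<Sum>i\<le>n. of_bool ((a, b) = (x (Suc i), y i)) - of_bool ((a, b) = (x i, y i)) :: real) =
          (\<Sum>i\<le>n. \<Sum>a\<in>A. of_bool ((a, b) = (x (Suc i), y i)) - of_bool ((a, b) = (x i, y i)))"
        by (rule sum.swap)
      also have "\<dots> = 0"
      proof (rule sum.neutral, intro ballI)
        fix i assume "i \<in> {..n}"
        have "(\<Sum>a\<in>A. of_bool ((a, b) = (x (Suc i), y i)) - of_bool ((a, b) = (x i, y i)) :: real) =
            (\<Sum>a\<in>A. if a = x (Suc i) then of_bool (b = y i) else 0) - (\<Sum>a\<in>A. if a = x i then of_bool (b = y i) else 0)"
          unfolding sum_subtractf by (intro arg_cong2[where f="(-)"] sum.cong) auto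
        then show "(\<Sum>a\<in>A. of_bool ((a, b) = (x (Suc i), y i)) - of_bool ((a, b) = (x i, y i)) :: real) = 0"
          using xA xA' \<open>i \<in> {..n}\<close> fin by simp
      qed
      finally show "(\<Sum>a\<in>A. h (a, b)) = q b" by simp
    qed
    then have "J h \<le> J g" by (rule gmax)
    moreover have "J h = J g + e * (\<Sum>i\<le>n. y i \<bullet> (x (Suc i) - x i))"
    proof -
      let ?c = "\<lambda>z :: 'a \<times> 'a. fst z \<bullet> snd z"
      have "J h = J g + e * (\<Sum>z\<in>A\<times>B. \<Sum>i\<le>n. (of_bool (z = (x (Suc i), y i)) - of_bool (z = (x i, y i))) * ?c z)"
        by (simp add: J_def h_def distrib_right sum.distrib sum_distrib_left sum_distrib_right mult.assoc)
      also have "(\<Sum>z\<in>A\<times>B. \<Sum>i\<le>n. (of_bool (z = (x (Suc i), y i)) - of_bool (z = (x i, y i))) * ?c z) =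
          (\<Sum>i\<le>n. \<Sum>z\<in>A\<times>B. (of_bool (z = (x (Suc i), y i)) - of_bool (z = (x i, y i))) * ?c z)"
        by (rule sum.swap)
      also have "\<dots> = (\<Sum>i\<le>n. y i \<bullet> (x (Suc i) - x i))"
      proof (rule sum.cong[OF refl])
        fix i assume "i \<in> {..n}"
        have "(\<Sum>z\<in>A\<times>B. (of_bool (z = (x (Suc i), y i)) - of_bool (z = (x i, y i))) * ?c z) =
            (\<Sum>z\<in>A\<times>B. if z = (x (Suc i), y i) then ?c (x (Suc i), y i) else 0) -
            (\<Sum>z\<in>A\<times>B. if z = (x i, y i) then ?c (x i, y i) else 0)"
          unfolding left_diff_distrib sum_subtractf by (intro arg_cong2[where f="(-)"] sum.cong) auto
        then show "(\<Sum>z\<in>A\<times>B. (of_bool (z = (x (Suc i), y i)) - of_bool (z = (x i, y i))) * ?c z) = y i \<bullet> (x (Suc i) - x i)"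
          using xA xA' yB \<open>i \<in> {..n}\<close> fin by (simp add: inner_diff_right inner_commute)
      qed
      finally show ?thesis .
    qed
    ultimately have "e * (\<Sum>i\<le>n. y i \<bullet> (x (Suc i) - x i)) \<le> 0" by simp
    then show "(\<Sum>i\<le>n. y i \<bullet> (x (Suc i) - x i)) \<le> 0"
      using e by (simp add: mult_le_0_iff)
  qed
  with g0 gz gp gq show ?thesis by (rule that)
qed

text \<open>The index type may be uncountable, where the cube is compact but need not be
  sequentially compact. Hence no convergent subsequence, only infinitely many \<open>n\<close> close
  to \<open>\<mu>\<close> on each finite set of coordinates.\<close>

lemma cluster_point_in_unit_cube:
  fixes \<nu> :: "nat \<Rightarrow> 's \<Rightarrow> real"
  assumes "\<And>n s. \<nu> n s \<in> {0..1}"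
  obtains \<mu> where "\<And>F e. finite F \<Longrightarrow> e > 0 \<Longrightarrow> \<exists>\<^sub>F n in sequentially. \<forall>s\<in>F. \<bar>\<nu> n s - \<mu> s\<bar> < e"
proof -
  let ?X = "Pi\<^sub>E UNIV (\<lambda>_::'s. {0..1::real})"
  let ?F = "filtermap \<nu> sequentially"
  have "compact ?X" by (rule compact_PiE_UNIV) simp
  moreover have "?F \<noteq> bot" by (simp add: filtermap_bot_iff)
  moreover have "eventually (\<lambda>x. x \<in> ?X) ?F"
    using assms by (simp add: eventually_filtermap PiE_iff)
  ultimately obtain \<mu> where \<mu>: "inf (nhds \<mu>) ?F \<noteq> bot"
    unfolding compact_filter by blast
  have "\<exists>\<^sub>F n in sequentially. \<forall>s\<in>F. \<bar>\<nu> n s - \<mu> s\<bar> < e" if "finite F" "e > 0" for F e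
  proof (rule ccontr)
    assume "\<not> ?thesis"
    then have ev: "eventually (\<lambda>f. \<not> (\<forall>s\<in>F. \<bar>f s - \<mu> s\<bar> < e)) ?F"
      by (simp add: not_frequently eventually_filtermap)
    let ?U = "\<Inter>s\<in>F. {f. \<bar>f s - \<mu> s\<bar> < e}"
    have "open {f. \<bar>f s - \<mu> s\<bar> < e}" for s
      by (intro open_Collect_less continuous_intros continuous_on_product_coordinates)
    then have "open ?U" using that by (intro open_INT) auto
    moreover have "\<mu> \<in> ?U" using that by auto
    ultimately have "eventually (\<lambda>f. f \<in> ?U) (nhds \<mu>)" by (rule eventually_nhds_in_open)
    then have "eventually (\<lambda>f. False) (inf (nhds \<mu>) ?F)"
      unfolding eventually_inf using ev by blast
    then show False using \<mu> by (simp add: trivial_limit_def)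
  qed
  then show ?thesis using that by blast
qed

subsection \<open>Finitely additive couplings\<close>

text \<open>Finite additivity and exact marginals are preserved by set-wise cluster points, while
  countable additivity need not be. Values on sets that are not Borel are left
  unconstrained.\<close>

locale additive_coupling =
  fixes P Q :: "'a::{real_inner, polish_space} measure" and \<mu> :: "('a \<times> 'a) set \<Rightarrow> real"
  assumes P: "P \<in> borel_prob_measures" and Q: "Q \<in> borel_prob_measures"
    and nonneg: "S \<in> sets borel \<Longrightarrow> 0 \<le> \<mu> S"
    and add: "S \<in> sets borel \<Longrightarrow> T \<in> sets borel \<Longrightarrow> S \<inter> T = {} \<Longrightarrow> \<mu> (S \<union> T) = \<mu> S + \<mu> T"
    and marginal1: "A \<in> sets borel \<Longrightarrow> \<mu> (A \<times> UNIV) = measure P A"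
    and marginal2: "B \<in> sets borel \<Longrightarrow> \<mu> (UNIV \<times> B) = measure Q B"

lemma sets_borel_Times:
  fixes A :: "'a::second_countable_topology set" and B :: "'b::second_countable_topology set"
  shows "A \<in> sets borel \<Longrightarrow> B \<in> sets borel \<Longrightarrow> A \<times> B \<in> sets borel"
  unfolding borel_prod[symmetric] by (rule pair_measureI)

lemma inner_regular_approx:
  fixes P :: "'a::polish_space measure"
  assumes P: "P \<in> borel_prob_measures" and A: "A \<in> sets borel" and e: "e > 0"
  obtains K where "compact K" "K \<subseteq> A" "measure P (A - K) < e"
proof -
  interpret prob_space P using P by (simp add: borel_prob_measures_def)
  have sets: "sets P = sets borel" using P by (simp add: borel_prob_measures_def)
  show ?thesis
  \<comment> \<open>For a null set \<open>ennreal (measure P A - e)\<close> is 0 by truncation, so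
    the strict inequality below would fail.\<close>
  proof (cases "measure P A = 0")
    case True
    then show ?thesis using that[of "{}"] e by simp
  next
    case False
    then have "measure P A > 0" by (simp add: zero_less_measure_iff)
    then have "ennreal (measure P A - e) < emeasure P A"
      unfolding emeasure_eq_measure using e by (intro ennreal_lessI) auto
    also have "emeasure P A = (SUP K \<in> {K. K \<subseteq> A \<and> compact K}. emeasure P K)"
      by (rule inner_regular[OF sets _ A]) simp
    finally obtain K where K: "K \<subseteq> A" "compact K" "ennreal (measure P A - e) < emeasure P K"
      unfolding less_SUP_iff by blast
    have Ks: "K \<in> sets P" using K(2) by (simp add: sets borel_compact)
    have "measure P A - e < measure P K"
    proof (rule ccontr)
      assume "\<not> ?thesis"
      then have "emeasure P K \<le> ennreal (measure P A - e)"
        unfolding emeasure_eq_measure by (intro ennreal_leI) simp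
      then show False using K(3) by simp
    qed
    moreover have "measure P (A - K) = measure P A - measure P K"
      using K(1) Ks A by (intro finite_measure_Diff) (auto simp: sets)
    ultimately have "measure P (A - K) < e" by simp
    then show ?thesis using K(1,2) that by blast
  qed
qed

context additive_coupling
begin

lemma sets_PQ [simp, measurable_cong]: "sets P = sets borel" "sets Q = sets borel"
  using P Q by (auto simp: borel_prob_measures_def)

lemma total: "\<mu> UNIV = 1"
proof -
  interpret P: prob_space P using P by (simp add: borel_prob_measures_def)
  have "space P = UNIV" using sets_eq_imp_space_eq[OF sets_PQ(1)] by simp
  then show ?thesis using marginal1[of UNIV] P.prob_space by simp
qed

lemma mono:
  assumes "S \<in> sets borel" "T \<in> sets borel" "S \<subseteq> T" shows "\<mu> S \<le> \<mu> T"
proof -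
  have "\<mu> T = \<mu> S + \<mu> (T - S)"
    using add[of S "T - S"] assms by (simp add: Un_absorb1)
  then show ?thesis using nonneg[of "T - S"] assms by simp
qed

lemma empty: "\<mu> {} = 0"
  using add[of "{}" "{}"] by simp

lemma subadd:
  assumes "S \<in> sets borel" "T \<in> sets borel" shows "\<mu> (S \<union> T) \<le> \<mu> S + \<mu> T"
  using add[of S "T - S"] mono[of "T - S" T] assms by simp

lemma subadd_finite:
  assumes "finite I" "\<And>i. i \<in> I \<Longrightarrow> S i \<in> sets borel"
  shows "\<mu> (\<Union>i\<in>I. S i) \<le> (\<Sum>i\<in>I. \<mu> (S i))"
  using assms
proof (induction I)
  case (insert i I)
  have "\<mu> (S i \<union> (\<Union>i\<in>I. S i)) \<le> \<mu> (S i) + \<mu> (\<Union>i\<in>I. S i)"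
    using insert by (intro subadd) auto
  then show ?case using insert by simp
qed (simp add: empty)

text \<open>Inner regularity by compact sets: the finite intersection property will turn it into
  continuity at the empty set.\<close>

definition tight_sets :: "('a \<times> 'a) set set" where
  "tight_sets = {S \<in> sets borel. \<forall>e>0. \<exists>K. compact K \<and> K \<subseteq> S \<and> \<mu> (S - K) < e}"

lemma tight_setsE:
  assumes "S \<in> tight_sets" "e > 0"
  obtains K where "compact K" "K \<subseteq> S" "\<mu> (S - K) < e" "K \<in> sets borel" "S \<in> sets borel"
  using assms unfolding tight_sets_def by (blast intro: borel_compact)

lemma tight_sets_Un_Int:
  assumes "S \<in> tight_sets" "T \<in> tight_sets"
  shows "S \<union> T \<in> tight_sets" "S \<inter> T \<in> tight_sets"
proof -
  have "(\<exists>K. compact K \<and> K \<subseteq> S \<union> T \<and> \<mu> (S \<union> T - K) < e) \<and>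
      (\<exists>K. compact K \<and> K \<subseteq> S \<inter> T \<and> \<mu> (S \<inter> T - K) < e)" if e: "e > 0" for e
  proof -
    obtain K where K: "compact K" "K \<subseteq> S" "\<mu> (S - K) < e / 2" "K \<in> sets borel" "S \<in> sets borel"
      using tight_setsE[OF assms(1), of "e / 2"] e by auto
    obtain L where L: "compact L" "L \<subseteq> T" "\<mu> (T - L) < e / 2" "L \<in> sets borel" "T \<in> sets borel"
      using tight_setsE[OF assms(2), of "e / 2"] e by auto
    have "\<mu> ((S - K) \<union> (T - L)) \<le> \<mu> (S - K) + \<mu> (T - L)"
      using K L by (intro subadd) auto
    then have small: "\<mu> ((S - K) \<union> (T - L)) < e" using K L by simp
    have "\<mu> (S \<union> T - (K \<union> L)) \<le> \<mu> ((S - K) \<union> (T - L))"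
      using K L by (intro mono) auto
    moreover have "\<mu> (S \<inter> T - (K \<inter> L)) \<le> \<mu> ((S - K) \<union> (T - L))"
      using K L by (intro mono) auto
    ultimately show ?thesis
      using small K L compact_Un[of K L] compact_Int[of K L]
      by (intro conjI exI[of _ "K \<union> L"] exI[of _ "K \<inter> L"]) auto
  qed
  then show "S \<union> T \<in> tight_sets" "S \<inter> T \<in> tight_sets"
    using assms by (auto simp: tight_sets_def)
qed

text \<open>What a compact rectangle misses lies in two strips, and \<open>\<mu>\<close> of a strip
  is a marginal probability. So regularity of \<open>P\<close> and \<open>Q\<close> suffices,
  whatever the coupling.\<close>

lemma tight_sets_Times:
  assumes A: "A \<in> sets borel" and B: "B \<in> sets borel" shows "A \<times> B \<in> tight_sets"
proof -
  have "\<exists>K. compact K \<and> K \<subseteq> A \<times> B \<and> \<mu> (A \<times> B - K) < e" if e: "e > 0" for e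
  proof -
    obtain K where K: "compact K" "K \<subseteq> A" "measure P (A - K) < e / 2"
      using inner_regular_approx[OF P A, of "e / 2"] e by auto
    obtain L where L: "compact L" "L \<subseteq> B" "measure Q (B - L) < e / 2"
      using inner_regular_approx[OF Q B, of "e / 2"] e by auto
    have KL: "K \<in> sets borel" "L \<in> sets borel" using K L by (auto intro: borel_compact)
    have "\<mu> (A \<times> B - K \<times> L) \<le> \<mu> ((A - K) \<times> UNIV \<union> UNIV \<times> (B - L))"
      using A B KL by (intro mono sets.Un sets.Diff sets_borel_Times) auto
    also have "\<dots> \<le> \<mu> ((A - K) \<times> UNIV) + \<mu> (UNIV \<times> (B - L))"
      using A B KL by (intro subadd sets_borel_Times) auto
    also have "\<dots> < e" using K L A B KL by (simp add: marginal1 marginal2)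
    finally show ?thesis using K L by (intro exI[of _ "K \<times> L"]) (auto intro: compact_Times)
  qed
  then show ?thesis using sets_borel_Times[OF A B] by (auto simp: tight_sets_def)
qed

text \<open>Requiring inner approximation of the complement as well turns \<open>tight_sets\<close> into an algebra;
  it contains all measurable rectangles because the marginals are Radon.\<close>

definition biregular_sets :: "('a \<times> 'a) set set" where
  "biregular_sets = {S. S \<in> tight_sets \<and> - S \<in> tight_sets}"

lemma algebra_biregular_sets: "algebra UNIV biregular_sets"
  unfolding algebra_iff_Un
proof (intro conjI ballI)
  have "{} \<times> {} \<in> tight_sets" "UNIV \<times> UNIV \<in> tight_sets" by (intro tight_sets_Times; simp)+
  then show "{} \<in> biregular_sets" by (simp add: biregular_sets_def)
  fix S T assume "S \<in> biregular_sets" "T \<in> biregular_sets"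
  then show "S \<union> T \<in> biregular_sets"
    by (auto simp: biregular_sets_def Compl_Un intro: tight_sets_Un_Int)
qed (auto simp: biregular_sets_def simp flip: Compl_eq_Diff_UNIV)

lemma biregular_sets_Times:
  assumes A: "A \<in> sets borel" and B: "B \<in> sets borel" shows "A \<times> B \<in> biregular_sets"
proof -
  have "- (A \<times> B) = (- A) \<times> UNIV \<union> UNIV \<times> (- B)" by auto
  also have "\<dots> \<in> tight_sets"
    using A B by (intro tight_sets_Un_Int tight_sets_Times) (auto simp: Compl_eq_Diff_UNIV)
  finally show ?thesis using tight_sets_Times[OF A B] by (simp add: biregular_sets_def)
qed

lemma sigma_sets_biregular: "sigma_sets UNIV biregular_sets = sets borel"
proof
  show "sigma_sets UNIV biregular_sets \<subseteq> sets borel"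
    using sets.sigma_sets_subset[of biregular_sets borel]
    by (auto simp: biregular_sets_def tight_sets_def)
  have "sets (borel :: ('a \<times> 'a) measure) = sigma_sets UNIV {a \<times> b | a b. a \<in> sets borel \<and> b \<in> sets borel}"
    unfolding borel_prod[symmetric] by (simp add: sets_pair_measure)
  also have "\<dots> \<subseteq> sigma_sets UNIV biregular_sets"
    by (intro sigma_sets_mono') (auto intro: biregular_sets_Times)
  finally show "sets borel \<subseteq> sigma_sets UNIV biregular_sets" .
qed

text \<open>Choose compact \<open>K i\<close> inside \<open>A i\<close> with defects summing to less
  than \<open>e\<close>. The \<open>K i\<close> have empty intersection, so finitely many of them
  already do; from then on \<open>A n\<close> is covered by finitely many defects, and finite
  subadditivity is enough.\<close>

lemma empty_continuous:
  assumes A: "range A \<subseteq> tight_sets" "decseq A" "(\<Inter>i. A i) = {}"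
  shows "(\<lambda>i. \<mu> (A i)) \<longlonglongrightarrow> 0"
proof (rule LIMSEQ_I)
  fix e :: real assume e: "e > 0"
  have Ab: "A i \<in> sets borel" for i using A(1) by (auto simp: tight_sets_def)
  have "\<exists>K. compact K \<and> K \<subseteq> A i \<and> \<mu> (A i - K) < e / 2 ^ Suc i \<and> K \<in> sets borel" for i
    using tight_setsE[of "A i" "e / 2 ^ Suc i"] A(1) e by (metis divide_pos_pos range_subsetD zero_less_numeral zero_less_power)
  then obtain K where K: "\<And>i. compact (K i)" "\<And>i. K i \<subseteq> A i" "\<And>i. \<mu> (A i - K i) < e / 2 ^ Suc i"
    "\<And>i. K i \<in> sets borel" by metis
  define L where "L n = (\<Inter>i\<le>n. K i)" for n
  have "\<exists>n. L n = {}"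
  proof (rule ccontr)
    assume nonempty: "\<not> ?thesis"
    have "K 0 \<inter> \<Inter>(range K) \<noteq> {}"
    proof (rule compact_imp_fip[OF K(1)])
      show "closed T" if "T \<in> range K" for T using that K(1) by (auto intro: compact_imp_closed)
      fix F assume "finite F" "F \<subseteq> range K"
      then obtain I where I: "finite I" "F = K ` I" by (metis finite_subset_image)
      then obtain n where "I \<subseteq> {..n}" using finite_nat_iff_bounded_le by blast
      then have "L n \<subseteq> K 0 \<inter> \<Inter>F" by (auto simp: L_def I)
      then show "K 0 \<inter> \<Inter>F \<noteq> {}" using nonempty by blast
    qed
    then show False using A(3) K(2) by blast
  qed
  then obtain n where n: "L n = {}" by blast
  have sum: "(\<Sum>i\<le>n. e / 2 ^ Suc i) = e * (1 - 1 / 2 ^ Suc n)" for n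
    by (induction n) (auto simp: field_simps)
  have "\<mu> (A n) \<le> \<mu> (\<Union>i\<le>n. A i - K i)"
  proof (rule mono)
    show "A n \<subseteq> (\<Union>i\<le>n. A i - K i)"
    proof
      fix z assume z: "z \<in> A n"
      then obtain i where "i \<le> n" "z \<notin> K i" using n by (auto simp: L_def)
      moreover have "z \<in> A i" using z A(2) \<open>i \<le> n\<close> by (auto simp: decseq_def)
      ultimately show "z \<in> (\<Union>i\<le>n. A i - K i)" by auto
    qed
  qed (use Ab K in auto)
  also have "\<dots> \<le> (\<Sum>i\<le>n. \<mu> (A i - K i))" by (rule subadd_finite) (use Ab K in auto)
  also have "\<dots> \<le> (\<Sum>i\<le>n. e / 2 ^ Suc i)" by (intro sum_mono less_imp_le K)
  also have "\<dots> < e" unfolding sum using e by (simp add: algebra_simps)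
  finally have *: "\<mu> (A n) < e" .
  have "norm (\<mu> (A m) - 0) < e" if "m \<ge> n" for m
    using mono[of "A m" "A n"] Ab A(2) that * nonneg[OF Ab[of m]] by (auto simp: decseq_def)
  then show "\<exists>no. \<forall>m\<ge>no. norm (\<mu> (A m) - 0) < e" by blast
qed

text \<open>Caratheodory's theorem on the algebra of biregular sets. On other Borel sets the merely
  finitely additive \<open>\<mu>\<close> may differ from the extension, so the two are compared on
  rectangles, which is where the construction uses \<open>\<mu>\<close>.\<close>

lemma sigma_additive_extension:
  obtains \<pi> where "sets \<pi> = sets borel" "prob_space \<pi>"
    "\<And>A B. A \<in> sets borel \<Longrightarrow> B \<in> sets borel \<Longrightarrow> measure \<pi> (A \<times> B) = \<mu> (A \<times> B)"
proof -
  interpret algebra UNIV biregular_sets by (rule algebra_biregular_sets)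
  have b: "S \<in> sets borel" if "S \<in> biregular_sets" for S
    using that by (auto simp: biregular_sets_def tight_sets_def)
  have "\<exists>m. (\<forall>S\<in>biregular_sets. m S = ennreal (\<mu> S)) \<and> measure_space UNIV (sigma_sets UNIV biregular_sets) m"
  proof (rule caratheodory_empty_continuous)
    show "positive biregular_sets (\<lambda>S. ennreal (\<mu> S))" by (simp add: positive_def empty)
    show "additive biregular_sets (\<lambda>S. ennreal (\<mu> S))"
      by (auto simp: additive_def add b nonneg simp flip: ennreal_plus)
    fix A :: "nat \<Rightarrow> ('a \<times> 'a) set"
    assume "range A \<subseteq> biregular_sets" "decseq A" "(\<Inter>i. A i) = {}"
    then have "(\<lambda>i. \<mu> (A i)) \<longlonglongrightarrow> 0"
      by (intro empty_continuous) (auto simp: biregular_sets_def)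
    then show "(\<lambda>i. ennreal (\<mu> (A i))) \<longlonglongrightarrow> 0"
      using tendsto_ennrealI[of "\<lambda>i. \<mu> (A i)" 0] by simp
  qed simp
  then obtain m where m: "\<And>S. S \<in> biregular_sets \<Longrightarrow> m S = ennreal (\<mu> S)"
    "measure_space UNIV (sets borel) m"
    unfolding sigma_sets_biregular by blast
  define \<pi> where "\<pi> = measure_of UNIV (sets borel) m"
  have sets: "sets \<pi> = sets borel"
    unfolding \<pi>_def using sets.sigma_sets_eq[of "borel :: ('a \<times> 'a) measure"] by simp
  have em: "emeasure \<pi> S = m S" if "S \<in> sets borel" for S
    unfolding \<pi>_def using m(2) that by (intro emeasure_measure_of_sigma) (auto simp: measure_space_def)
  have rect: "emeasure \<pi> (A \<times> B) = ennreal (\<mu> (A \<times> B))" if "A \<in> sets borel" "B \<in> sets borel" for A B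
    using that em[OF sets_borel_Times] m(1)[OF biregular_sets_Times] by simp
  have "space \<pi> = UNIV" using sets_eq_imp_space_eq[OF sets] by simp
  then have "prob_space \<pi>"
    using rect[of UNIV UNIV] total by (intro prob_spaceI) simp
  moreover have "measure \<pi> (A \<times> B) = \<mu> (A \<times> B)" if "A \<in> sets borel" "B \<in> sets borel" for A B
    using rect[OF that] nonneg[OF sets_borel_Times[OF that]] by (simp add: measure_def)
  ultimately show ?thesis using that sets by blast
qed

end

text \<open>The optimal coupling \<open>g\<close> of the discretised laws is lifted by spreading
  \<open>g (a, b)\<close> over the cell \<open>F a \<times> F b\<close> as the product of the
  conditional laws. The marginals are then exactly \<open>P\<close> and \<open>Q\<close>; only the
  monotonicity refers to the discretised points \<open>(\<Phi> x, \<Phi> y)\<close>.\<close>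

lemma approximate_coupling:
  fixes P Q :: "'a::{real_inner, polish_space} measure" and \<Phi> :: "'a \<Rightarrow> 'a"
  assumes P: "P \<in> borel_prob_measures" and Q: "Q \<in> borel_prob_measures"
    and \<Phi>: "\<Phi> \<in> borel_measurable borel" "finite (range \<Phi>)"
  obtains \<mu> \<Gamma> where "additive_coupling P Q \<mu>" "cyclically_monotone \<Gamma>"
    "\<And>S. S \<in> sets borel \<Longrightarrow> (\<And>x y. (x, y) \<in> S \<Longrightarrow> (\<Phi> x, \<Phi> y) \<notin> \<Gamma>) \<Longrightarrow> \<mu> S = 0"
proof -
  interpret P: prob_space P using P by (simp add: borel_prob_measures_def)
  interpret Q: prob_space Q using Q by (simp add: borel_prob_measures_def)
  interpret PQ: pair_prob_space P Q ..
  have sP: "sets P = sets borel" and sQ: "sets Q = sets borel"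
    using P Q by (auto simp: borel_prob_measures_def)
  have spP: "space P = UNIV" and spQ: "space Q = UNIV"
    using sets_eq_imp_space_eq[OF sP] sets_eq_imp_space_eq[OF sQ] by simp_all
  let ?M = "P \<Otimes>\<^sub>M Q"
  have sM: "sets ?M = sets borel"
    unfolding borel_prod[symmetric] by (rule sets_pair_measure_cong[OF sP sQ])
  have times: "measure ?M (A \<times> B) = measure P A * measure Q B" if "A \<in> sets borel" "B \<in> sets borel" for A B
    using that by (simp add: measure_def Q.emeasure_pair_measure_Times sP sQ enn2real_mult)
  let ?R = "range \<Phi>"
  define F where "F a = \<Phi> -` {a}" for a
  have Fb: "F a \<in> sets borel" for a
    using measurable_sets[OF \<Phi>(1), of "{a}"] by (simp add: F_def)
  have part: "(\<Sum>a\<in>?R. measure N (A \<inter> F a)) = measure N A"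
    if "finite_measure N" "sets N = sets borel" "A \<in> sets borel" for N :: "'a measure" and A
  proof -
    interpret finite_measure N by fact
    have "measure N (\<Union>a\<in>?R. A \<inter> F a) = (\<Sum>a\<in>?R. measure N (A \<inter> F a))"
      by (rule finite_measure_finite_Union[OF \<Phi>(2)])
        (use that Fb in \<open>auto simp: disjoint_family_on_def F_def\<close>)
    moreover have "(\<Union>a\<in>?R. A \<inter> F a) = A" by (auto simp: F_def)
    ultimately show ?thesis by simp
  qed
  have partP: "(\<Sum>a\<in>?R. measure P (A \<inter> F a)) = measure P A" if "A \<in> sets borel" for A
    by (rule part) (use that sP P.finite_measure_axioms in auto)
  have partQ: "(\<Sum>a\<in>?R. measure Q (A \<inter> F a)) = measure Q A" if "A \<in> sets borel" for A
    by (rule part) (use that sQ Q.finite_measure_axioms in auto)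
  define p where "p a = measure P (F a)" for a
  define q where "q a = measure Q (F a)" for a
  have "sum p ?R = 1" "sum q ?R = 1"
    using partP[of UNIV] partQ[of UNIV] P.prob_space Q.prob_space by (simp_all add: p_def q_def spP spQ)
  then obtain g :: "'a \<times> 'a \<Rightarrow> real" where g: "\<And>z. 0 \<le> g z" "\<And>z. z \<notin> ?R \<times> ?R \<Longrightarrow> g z = 0"
    "\<And>a. a \<in> ?R \<Longrightarrow> (\<Sum>b\<in>?R. g (a, b)) = p a" "\<And>b. b \<in> ?R \<Longrightarrow> (\<Sum>a\<in>?R. g (a, b)) = q b"
    "cyclically_monotone {z. g z > 0}"
    using finite_optimal_coupling[OF \<Phi>(2) \<Phi>(2), of p q] by (auto simp: p_def q_def)
  have gp: "g (a, b) = 0" if "p a = 0" "a \<in> ?R" "b \<in> ?R" for a b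
  proof -
    have "g (a, b) \<le> (\<Sum>b\<in>?R. g (a, b))" by (rule member_le_sum) (use that g(1) \<Phi>(2) in auto)
    then show ?thesis using g(1)[of "(a, b)"] g(3)[OF that(2)] that(1) by simp
  qed
  have gq: "g (a, b) = 0" if "q b = 0" "a \<in> ?R" "b \<in> ?R" for a b
  proof -
    have "g (a, b) \<le> (\<Sum>a\<in>?R. g (a, b))"
      using member_le_sum[of a ?R "\<lambda>a. g (a, b)"] that g(1) \<Phi>(2) by simp
    then show ?thesis using g(1)[of "(a, b)"] g(4)[OF that(3)] that(1) by simp
  qed
  \<comment> \<open>If \<open>p a\<close> or \<open>q b\<close> is 0, the quotient is 0 by the
    convention on division; \<open>gp\<close> and \<open>gq\<close> show that \<open>g\<close> puts
    no mass on such a cell, so nothing is lost.\<close>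
  define \<mu> where "\<mu> S = (\<Sum>a\<in>?R. \<Sum>b\<in>?R. g (a, b) / (p a * q b) * measure ?M (S \<inter> (F a \<times> F b)))" for S
  have FF: "F a \<times> F b \<in> sets borel" for a b by (intro sets_borel_Times Fb)
  have "additive_coupling P Q \<mu>"
  proof
    show "0 \<le> \<mu> S" if "S \<in> sets borel" for S
      unfolding \<mu>_def p_def q_def
      by (intro sum_nonneg mult_nonneg_nonneg divide_nonneg_nonneg measure_nonneg g(1))
    show "\<mu> (S \<union> T) = \<mu> S + \<mu> T" if "S \<in> sets borel" "T \<in> sets borel" "S \<inter> T = {}" for S T
    proof -
      have "measure ?M ((S \<union> T) \<inter> (F a \<times> F b)) =
          measure ?M (S \<inter> (F a \<times> F b)) + measure ?M (T \<inter> (F a \<times> F b))" for a b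
        unfolding Int_Un_distrib2
        by (rule PQ.finite_measure_Union) (use that FF[of a b] in \<open>auto simp: sM\<close>)
      then show ?thesis unfolding \<mu>_def by (simp add: distrib_left sum.distrib)
    qed
    show "\<mu> (A \<times> UNIV) = measure P A" if A: "A \<in> sets borel" for A
    proof -
      have "\<mu> (A \<times> UNIV) = (\<Sum>a\<in>?R. measure P (A \<inter> F a))"
        unfolding \<mu>_def
      proof (rule sum.cong[OF refl])
        fix a assume a: "a \<in> ?R"
        have "g (a, b) / (p a * q b) * measure ?M (A \<times> UNIV \<inter> F a \<times> F b) =
            g (a, b) * (measure P (A \<inter> F a) / p a)" if b: "b \<in> ?R" for b
        proof (cases "q b = 0")
          case False
          have "A \<times> UNIV \<inter> F a \<times> F b = (A \<inter> F a) \<times> F b" by auto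
          then show ?thesis using False times[of "A \<inter> F a" "F b"] A Fb by (simp add: q_def)
        qed (simp add: gq[OF _ a b])
        then have "(\<Sum>b\<in>?R. g (a, b) / (p a * q b) * measure ?M (A \<times> UNIV \<inter> F a \<times> F b)) =
            (\<Sum>b\<in>?R. g (a, b) * (measure P (A \<inter> F a) / p a))"
          by (rule sum.cong[OF refl])
        then have "(\<Sum>b\<in>?R. g (a, b) / (p a * q b) * measure ?M (A \<times> UNIV \<inter> F a \<times> F b)) =
            p a * (measure P (A \<inter> F a) / p a)"
          unfolding sum_distrib_right[symmetric] g(3)[OF a] .
        moreover have "measure P (A \<inter> F a) \<le> p a"
          unfolding p_def by (rule P.finite_measure_mono) (use Fb sP in auto)
        then have "p a = 0 \<Longrightarrow> measure P (A \<inter> F a) = 0"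
          using measure_nonneg[of P "A \<inter> F a"] by linarith
        ultimately show "(\<Sum>b\<in>?R. g (a, b) / (p a * q b) * measure ?M (A \<times> UNIV \<inter> F a \<times> F b)) =
            measure P (A \<inter> F a)" by (cases "p a = 0") simp_all
      qed
      then show ?thesis using partP[OF A] by simp
    qed
    show "\<mu> (UNIV \<times> B) = measure Q B" if B: "B \<in> sets borel" for B
    proof -
      have "\<mu> (UNIV \<times> B) = (\<Sum>b\<in>?R. \<Sum>a\<in>?R. g (a, b) / (p a * q b) * measure ?M (UNIV \<times> B \<inter> F a \<times> F b))"
        unfolding \<mu>_def by (rule sum.swap)
      also have "\<dots> = (\<Sum>b\<in>?R. measure Q (B \<inter> F b))"
      proof (rule sum.cong[OF refl])
        fix b assume b: "b \<in> ?R"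
        have "g (a, b) / (p a * q b) * measure ?M (UNIV \<times> B \<inter> F a \<times> F b) =
            g (a, b) * (measure Q (B \<inter> F b) / q b)" if a: "a \<in> ?R" for a
        proof (cases "p a = 0")
          case False
          have "UNIV \<times> B \<inter> F a \<times> F b = F a \<times> (B \<inter> F b)" by auto
          then show ?thesis using False times[of "F a" "B \<inter> F b"] B Fb by (simp add: p_def)
        qed (simp add: gp[OF _ a b])
        then have "(\<Sum>a\<in>?R. g (a, b) / (p a * q b) * measure ?M (UNIV \<times> B \<inter> F a \<times> F b)) =
            (\<Sum>a\<in>?R. g (a, b) * (measure Q (B \<inter> F b) / q b))"
          by (rule sum.cong[OF refl])
        then have "(\<Sum>a\<in>?R. g (a, b) / (p a * q b) * measure ?M (UNIV \<times> B \<inter> F a \<times> F b)) =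
            q b * (measure Q (B \<inter> F b) / q b)"
          unfolding sum_distrib_right[symmetric] g(4)[OF b] .
        moreover have "measure Q (B \<inter> F b) \<le> q b"
          unfolding q_def by (rule Q.finite_measure_mono) (use Fb sQ in auto)
        then have "q b = 0 \<Longrightarrow> measure Q (B \<inter> F b) = 0"
          using measure_nonneg[of Q "B \<inter> F b"] by linarith
        ultimately show "(\<Sum>a\<in>?R. g (a, b) / (p a * q b) * measure ?M (UNIV \<times> B \<inter> F a \<times> F b)) =
            measure Q (B \<inter> F b)" by (cases "q b = 0") simp_all
      qed
      finally show ?thesis using partQ[OF B] by simp
    qed
  qed (use P Q in auto)
  moreover have "\<mu> S = 0" if S: "S \<in> sets borel" "\<And>x y. (x, y) \<in> S \<Longrightarrow> (\<Phi> x, \<Phi> y) \<notin> {z. g z > 0}" for S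
    unfolding \<mu>_def
  proof (intro sum.neutral ballI)
    fix a b
    show "g (a, b) / (p a * q b) * measure ?M (S \<inter> F a \<times> F b) = 0"
    proof (cases "g (a, b) > 0")
      case True
      then have "S \<inter> F a \<times> F b = {}" using S(2) by (auto simp: F_def)
      then show ?thesis by simp
    next
      case False
      then have "g (a, b) = 0" using g(1)[of "(a, b)"] by simp
      then show ?thesis by simp
    qed
  qed
  ultimately show ?thesis using g(5) that by blast
qed

section \<open>Finite-valued Borel approximations of the identity\<close>

primrec nearest_point :: "nat \<Rightarrow> 'a \<Rightarrow> 'a::{metric_space, second_countable_topology}" where
  "nearest_point 0 x = dense_sequence 0"
| "nearest_point (Suc n) x =
    (if dist x (dense_sequence (Suc n)) < dist x (nearest_point n x) then dense_sequence (Suc n)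
     else nearest_point n x)"

lemma nearest_point_measurable:
  "(nearest_point n :: 'a \<Rightarrow> 'a::{metric_space, second_countable_topology}) \<in> borel_measurable borel"
proof (induction n)
  case (Suc n)
  note Suc.IH [measurable]
  have eq: "nearest_point (Suc n) = (\<lambda>x :: 'a. if dist x (dense_sequence (Suc n)) < dist x (nearest_point n x)
      then dense_sequence (Suc n) else nearest_point n x :: 'a)"
    by (rule ext) simp
  show ?case unfolding eq by measurable
qed simp

lemma finite_range_nearest_point: "finite (range (nearest_point n))"
proof (rule finite_subset)
  have "nearest_point n x \<in> dense_sequence ` {..n}" for x :: 'a
    by (induction n) auto
  then show "range (nearest_point n :: 'a \<Rightarrow> 'a) \<subseteq> dense_sequence ` {..n}" by blast
qed simp

lemma dist_nearest_point: "i \<le> n \<Longrightarrow> dist x (nearest_point n x) \<le> dist x (dense_sequence i)"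
proof (induction n)
  case (Suc n)
  then show ?case by (cases "i = Suc n") auto
qed simp

text \<open>Uniformity over a ball is needed since the points that are discretised will vary with
  \<open>n\<close>. Some dense point lies within \<open>e / 4\<close> of \<open>x\<close>, hence
  within \<open>e / 2\<close> of each \<open>u\<close> in the ball, so the nearest point is within
  \<open>3 * e / 4\<close> of \<open>x\<close>.\<close>

lemma nearest_point_uniformly_close:
  fixes x :: "'a::{metric_space, second_countable_topology}"
  assumes "e > 0"
  shows "\<forall>\<^sub>F n in sequentially. \<forall>u\<in>ball x (e / 4). dist (nearest_point n u) x \<le> e"
proof -
  obtain i where i: "(dense_sequence i :: 'a) \<in> ball x (e / 4)"
    using dense_sequence[of "ball x (e / 4)"] assms by auto
  have "dist (nearest_point n u) x \<le> e" if "i \<le> n" "dist x u < e / 4" for n u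
  proof -
    have "dist u (nearest_point n u) \<le> dist u (dense_sequence i)"
      by (rule dist_nearest_point) fact
    also have "\<dots> \<le> dist x u + dist x (dense_sequence i)"
      by (rule dist_triangle3)
    finally show ?thesis
      using dist_triangle3[of "nearest_point n u" x u] i that(2) assms
      by (simp add: dist_commute)
  qed
  then show ?thesis by (intro eventually_sequentiallyI[of i] ballI) (simp only: mem_ball)
qed

text \<open>Passing to the limit is set-wise on all Borel sets at once, along a cluster point for the product
  topology; no weak convergence of measures is involved.\<close>

lemma additive_coupling_cluster:
  fixes P Q :: "'a::{real_inner, polish_space} measure"
  assumes \<nu>: "\<And>n. additive_coupling P Q (\<nu> n)"
  obtains \<mu> where "additive_coupling P Q \<mu>"
    "\<And>F. finite F \<Longrightarrow> F \<subseteq> {S \<in> sets borel. \<mu> S > 0} \<Longrightarrow> \<exists>\<^sub>F n in sequentially. \<forall>S\<in>F. \<nu> n S > 0"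
proof -
  \<comment> \<open>\<open>\<nu> n\<close> is arbitrary off the Borel sets; setting it to 0 there
    puts the whole function into the unit cube.\<close>
  define \<nu>' where "\<nu>' n S = (if S \<in> sets borel then \<nu> n S else 0)" for n S
  have unit: "\<nu>' n S \<in> {0..1}" for n S
  proof -
    interpret additive_coupling P Q "\<nu> n" by (rule \<nu>)
    show ?thesis using nonneg mono[of S UNIV] total by (simp add: \<nu>'_def)
  qed
  obtain \<mu> where cl: "\<And>F e. finite F \<Longrightarrow> e > 0 \<Longrightarrow> \<exists>\<^sub>F n in sequentially. \<forall>S\<in>F. \<bar>\<nu>' n S - \<mu> S\<bar> < e"
    by (rule cluster_point_in_unit_cube[of \<nu>', OF unit]) blast
  have approx: "\<exists>n. \<forall>S\<in>F. \<bar>\<nu> n S - \<mu> S\<bar> < e" if F: "finite F" "F \<subseteq> sets borel" "e > 0" for F e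
  proof -
    obtain n where "\<forall>S\<in>F. \<bar>\<nu>' n S - \<mu> S\<bar> < e" using frequently_ex[OF cl[OF F(1,3)]] by blast
    then have "\<forall>S\<in>F. \<bar>\<nu> n S - \<mu> S\<bar> < e" using F(2) by (simp add: \<nu>'_def subset_iff)
    then show ?thesis ..
  qed
  have "additive_coupling P Q \<mu>"
  proof
    show "P \<in> borel_prob_measures" "Q \<in> borel_prob_measures"
      using \<nu>[of 0] by (auto simp: additive_coupling_def)
    show "0 \<le> \<mu> S" if S: "S \<in> sets borel" for S
    proof (rule field_le_epsilon)
      fix e :: real assume "e > 0"
      then obtain n where "\<bar>\<nu> n S - \<mu> S\<bar> < e" using approx[of "{S}" e] S by auto
      then show "0 \<le> \<mu> S + e" using additive_coupling.nonneg[OF \<nu> S, of n] by linarith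
    qed
    show "\<mu> (S \<union> T) = \<mu> S + \<mu> T" if S: "S \<in> sets borel" "T \<in> sets borel" "S \<inter> T = {}" for S T
    proof -
      have "\<bar>\<mu> (S \<union> T) - (\<mu> S + \<mu> T)\<bar> \<le> 0 + e" if "e > 0" for e
      proof -
        obtain n where "\<bar>\<nu> n S - \<mu> S\<bar> < e / 3" "\<bar>\<nu> n T - \<mu> T\<bar> < e / 3" "\<bar>\<nu> n (S \<union> T) - \<mu> (S \<union> T)\<bar> < e / 3"
          using approx[of "{S, T, S \<union> T}" "e / 3"] S \<open>e > 0\<close> by auto
        then show ?thesis using additive_coupling.add[OF \<nu> S, of n] by linarith
      qed
      then have "\<bar>\<mu> (S \<union> T) - (\<mu> S + \<mu> T)\<bar> \<le> 0" by (rule field_le_epsilon)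
      then show ?thesis by simp
    qed
    have eq: "\<mu> S = c" if S: "S \<in> sets borel" "\<And>n. \<nu> n S = c" for S c
    proof -
      have "\<bar>\<mu> S - c\<bar> \<le> 0 + e" if "e > 0" for e
        using approx[of "{S}" e] S \<open>e > 0\<close> by auto
      then have "\<bar>\<mu> S - c\<bar> \<le> 0" by (rule field_le_epsilon)
      then show ?thesis by simp
    qed
    show "\<mu> (A \<times> UNIV) = measure P A" if "A \<in> sets borel" for A
      using that by (intro eq additive_coupling.marginal1[OF \<nu>] sets_borel_Times) auto
    show "\<mu> (UNIV \<times> B) = measure Q B" if "B \<in> sets borel" for B
      using that by (intro eq additive_coupling.marginal2[OF \<nu>] sets_borel_Times) auto
  qed
  moreover have "\<exists>\<^sub>F n in sequentially. \<forall>S\<in>F. \<nu> n S > 0"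
    if F: "finite F" "F \<subseteq> {S \<in> sets borel. \<mu> S > 0}" for F
  proof -
    \<comment> \<open>An error below the smallest value of \<open>\<mu>\<close> on \<open>F\<close>
      preserves positivity; the inserted 1 covers empty \<open>F\<close>.\<close>
    define e where "e = Min (insert 1 (\<mu> ` F))"
    have "e > 0" unfolding e_def using F by (subst Min_gr_iff) auto
    have e_le: "e \<le> \<mu> S" if "S \<in> F" for S unfolding e_def using F that by (intro Min_le) auto
    show ?thesis
    proof (rule frequently_elim1[OF cl[OF F(1) \<open>e > 0\<close>]], intro ballI)
      fix n S assume "\<forall>S\<in>F. \<bar>\<nu>' n S - \<mu> S\<bar> < e" "S \<in> F"
      moreover have "\<nu>' n S = \<nu> n S" using F \<open>S \<in> F\<close> by (auto simp: \<nu>'_def)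
      ultimately show "\<nu> n S > 0" using e_le[of S] by force
    qed
  qed
  ultimately show ?thesis by (rule that)
qed

text \<open>Small rectangles around the finitely many points of a cycle in the support of
  \<open>\<mu>\<close> have positive \<open>\<nu> k\<close> simultaneously for infinitely many
  \<open>k\<close>. Each then contains a pair whose discretisation lies in \<open>G k\<close>, so
  the cycle is a limit of cycles with nonpositive sums.\<close>

lemma cyclically_monotone_coupling_exists:
  fixes P Q :: "'a::{real_inner, polish_space} measure"
  assumes P: "P \<in> borel_prob_measures" and Q: "Q \<in> borel_prob_measures"
  obtains \<pi> \<Gamma> where "sets \<pi> = sets borel" "prob_space \<pi>" "cyclically_monotone \<Gamma>" "AE z in \<pi>. z \<in> \<Gamma>"
    "\<And>A. A \<in> sets borel \<Longrightarrow> measure \<pi> (A \<times> UNIV) = measure P A"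
    "\<And>B. B \<in> sets borel \<Longrightarrow> measure \<pi> (UNIV \<times> B) = measure Q B"
proof -
  let ?\<Phi> = "nearest_point :: nat \<Rightarrow> 'a \<Rightarrow> 'a"
  have "\<exists>\<mu> \<Gamma>. additive_coupling P Q \<mu> \<and> cyclically_monotone \<Gamma> \<and>
      (\<forall>S\<in>sets borel. (\<forall>x y. (x, y) \<in> S \<longrightarrow> (?\<Phi> n x, ?\<Phi> n y) \<notin> \<Gamma>) \<longrightarrow> \<mu> S = 0)" for n
    by (rule approximate_coupling[OF P Q nearest_point_measurable[of n] finite_range_nearest_point[of n]]) blast
  then obtain \<nu> G where \<nu>: "\<And>n. additive_coupling P Q (\<nu> n)" and G: "\<And>n. cyclically_monotone (G n)"
    and \<nu>G: "\<And>n S. S \<in> sets borel \<Longrightarrow> (\<forall>x y. (x, y) \<in> S \<longrightarrow> (?\<Phi> n x, ?\<Phi> n y) \<notin> G n) \<Longrightarrow> \<nu> n S = 0"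
    by metis
  obtain \<mu> where \<mu>: "additive_coupling P Q \<mu>"
    and freq: "\<And>F. finite F \<Longrightarrow> F \<subseteq> {S \<in> sets borel. \<mu> S > 0} \<Longrightarrow> \<exists>\<^sub>F n in sequentially. \<forall>S\<in>F. \<nu> n S > 0"
    by (rule additive_coupling_cluster[of P Q \<nu>, OF \<nu>]) (rule that)
  interpret additive_coupling P Q \<mu> by (rule \<mu>)
  \<comment> \<open>The support of \<open>\<mu>\<close>, tested on open rectangles only, because
    there the extension \<open>\<pi>\<close> agrees with \<open>\<mu>\<close>.\<close>
  define \<Gamma> where "\<Gamma> = {(x, y). \<forall>U V. open U \<longrightarrow> open V \<longrightarrow> x \<in> U \<longrightarrow> y \<in> V \<longrightarrow> \<mu> (U \<times> V) > 0}"
  have open_b: "U \<times> V \<in> sets borel" if "open U" "open V" for U V :: "'a set"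
    using that by (intro sets_borel_Times) auto
  have mono_\<Gamma>: "cyclically_monotone \<Gamma>"
    unfolding cyclically_monotone_def
  proof (intro allI impI)
    fix n and x y :: "nat \<Rightarrow> 'a"
    assume cyc: "x (Suc n) = x 0" and xy: "\<forall>i\<le>n. (x i, y i) \<in> \<Gamma>"
    have near: "\<exists>u v. (\<forall>i\<le>Suc n. dist (u i) (x i) \<le> e) \<and> (\<forall>i\<le>n. dist (v i) (y i) \<le> e) \<and>
        (\<Sum>i\<le>n. v i \<bullet> (u (Suc i) - u i)) \<le> 0" if e: "e > 0" for e
    proof -
      let ?F = "(\<lambda>i. ball (x i) (e/4) \<times> ball (y i) (e/4)) ` {..n}"
      have "?F \<subseteq> {S \<in> sets borel. \<mu> S > 0}"
      proof (intro subsetI, elim imageE)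
        fix S i assume i: "i \<in> {..n}" and S: "S = ball (x i) (e/4) \<times> ball (y i) (e/4)"
        have "(x i, y i) \<in> \<Gamma>" using xy i by simp
        then have "\<mu> S > 0" unfolding \<Gamma>_def S using e by simp
        then show "S \<in> {S \<in> sets borel. \<mu> S > 0}" using open_b by (simp add: S)
      qed
      then have "\<exists>\<^sub>F k in sequentially. \<forall>S\<in>?F. \<nu> k S > 0" by (intro freq) auto
      moreover have "\<forall>\<^sub>F k in sequentially. \<forall>i\<in>{..n}. \<forall>u\<in>ball (x i) (e/4). dist (?\<Phi> k u) (x i) \<le> e"
        by (intro eventually_ball_finite ballI nearest_point_uniformly_close e) auto
      moreover have "\<forall>\<^sub>F k in sequentially. \<forall>i\<in>{..n}. \<forall>u\<in>ball (y i) (e/4). dist (?\<Phi> k u) (y i) \<le> e"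
        by (intro eventually_ball_finite ballI nearest_point_uniformly_close e) auto
      \<comment> \<open>Positivity holds for infinitely many \<open>k\<close> and closeness for all
        large \<open>k\<close>, so a single \<open>k\<close> has both.\<close>
      ultimately have "\<exists>\<^sub>F k in sequentially. (\<forall>S\<in>?F. \<nu> k S > 0) \<and>
          (\<forall>i\<in>{..n}. \<forall>u\<in>ball (x i) (e/4). dist (?\<Phi> k u) (x i) \<le> e) \<and>
          (\<forall>i\<in>{..n}. \<forall>u\<in>ball (y i) (e/4). dist (?\<Phi> k u) (y i) \<le> e)"
        by (intro frequently_eventually_frequently eventually_conj)
      then obtain k where k: "\<forall>S\<in>?F. \<nu> k S > 0"
        "\<forall>i\<in>{..n}. \<forall>u\<in>ball (x i) (e/4). dist (?\<Phi> k u) (x i) \<le> e"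
        "\<forall>i\<in>{..n}. \<forall>u\<in>ball (y i) (e/4). dist (?\<Phi> k u) (y i) \<le> e"
        by (blast dest: frequently_ex)
      have "\<exists>a b. a \<in> ball (x i) (e/4) \<and> b \<in> ball (y i) (e/4) \<and> (?\<Phi> k a, ?\<Phi> k b) \<in> G k" if i: "i \<le> n" for i
      proof (rule ccontr)
        assume "\<not> ?thesis"
        then have "\<nu> k (ball (x i) (e/4) \<times> ball (y i) (e/4)) = 0"
          by (intro \<nu>G open_b) auto
        moreover have "\<nu> k (ball (x i) (e/4) \<times> ball (y i) (e/4)) > 0"
          by (rule bspec[OF k(1)]) (use i in blast)
        ultimately show False by simp
      qed
      then have "\<forall>i\<in>{..n}. \<exists>z. fst z \<in> ball (x i) (e/4) \<and> snd z \<in> ball (y i) (e/4) \<and>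
          (?\<Phi> k (fst z), ?\<Phi> k (snd z)) \<in> G k"
        unfolding split_paired_Ex fst_conv snd_conv by blast
      from bchoice[OF this] obtain z where z: "\<forall>i\<in>{..n}. fst (z i) \<in> ball (x i) (e/4) \<and>
          snd (z i) \<in> ball (y i) (e/4) \<and> (?\<Phi> k (fst (z i)), ?\<Phi> k (snd (z i))) \<in> G k" ..
      define a b where "a i = fst (z i)" and "b i = snd (z i)" for i
      have ab: "a i \<in> ball (x i) (e/4)" "b i \<in> ball (y i) (e/4)" "(?\<Phi> k (a i), ?\<Phi> k (b i)) \<in> G k"
        if "i \<le> n" for i
        using bspec[OF z, of i] that unfolding a_def b_def by simp_all
      define u where "u i = (if i \<le> n then ?\<Phi> k (a i) else ?\<Phi> k (a 0))" for i
      define v where "v i = ?\<Phi> k (b i)" for i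
      have u_Suc: "u (Suc n) = u 0" by (simp add: u_def)
      have sum_le: "(\<Sum>i\<le>n. v i \<bullet> (u (Suc i) - u i)) \<le> 0"
      proof (rule G[of k, unfolded cyclically_monotone_def, rule_format, OF u_Suc])
        show "(u i, v i) \<in> G k" if "i \<le> n" for i using ab(3)[OF that] that by (simp add: u_def v_def)
      qed
      have du: "dist (u i) (x i) \<le> e" if "i \<le> n" for i
        using bspec[OF bspec[OF k(2)] ab(1)[OF that]] that by (simp add: u_def)
      have du': "\<forall>i\<le>Suc n. dist (u i) (x i) \<le> e"
        using du du[of 0] by (simp add: le_Suc_eq u_Suc cyc all_conj_distrib)
      have dv: "\<forall>i\<le>n. dist (v i) (y i) \<le> e"
        using bspec[OF bspec[OF k(3)] ab(2)] by (simp add: v_def)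
      show ?thesis by (intro exI[of _ u] exI[of _ v] conjI du' dv sum_le)
    qed
    have "\<forall>k. \<exists>w. (\<forall>i\<le>Suc n. dist (fst w i) (x i) \<le> 1 / Suc k) \<and>
        (\<forall>i\<le>n. dist (snd w i) (y i) \<le> 1 / Suc k) \<and>
        (\<Sum>i\<le>n. snd w i \<bullet> (fst w (Suc i) - fst w i)) \<le> 0"
      unfolding split_paired_Ex fst_conv snd_conv by (intro allI near) simp
    from choice[OF this] obtain w where w: "\<forall>k. (\<forall>i\<le>Suc n. dist (fst (w k) i) (x i) \<le> 1 / Suc k) \<and>
        (\<forall>i\<le>n. dist (snd (w k) i) (y i) \<le> 1 / Suc k) \<and>
        (\<Sum>i\<le>n. snd (w k) i \<bullet> (fst (w k) (Suc i) - fst (w k) i)) \<le> 0" ..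
    define u v where "u k = fst (w k)" and "v k = snd (w k)" for k
    have uv: "\<And>k i. i \<le> Suc n \<Longrightarrow> dist (u k i) (x i) \<le> 1 / Suc k"
      "\<And>k i. i \<le> n \<Longrightarrow> dist (v k i) (y i) \<le> 1 / Suc k"
      "\<And>k. (\<Sum>i\<le>n. v k i \<bullet> (u k (Suc i) - u k i)) \<le> 0"
      using w unfolding u_def v_def by blast+
    have lim: "f \<longlonglongrightarrow> l" if "\<And>k. dist (f k) l \<le> 1 / real (Suc k)" for f and l :: 'a
    proof (rule metric_tendsto_imp_tendsto[OF LIMSEQ_Suc[OF lim_1_over_n]])
      show "\<forall>\<^sub>F k in sequentially. dist (f k) l \<le> dist (1 / real (Suc k)) 0"
        using that by (intro always_eventually allI) simp
    qed
    have "(\<lambda>k. \<Sum>i\<le>n. v k i \<bullet> (u k (Suc i) - u k i)) \<longlonglongrightarrow> (\<Sum>i\<le>n. y i \<bullet> (x (Suc i) - x i))"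
      by (intro tendsto_sum tendsto_inner tendsto_diff lim uv) auto
    then show "(\<Sum>i\<le>n. y i \<bullet> (x (Suc i) - x i)) \<le> 0"
      by (rule LIMSEQ_le_const2) (use uv(3) in auto)
  qed
  obtain \<pi> where \<pi>: "sets \<pi> = sets borel" "prob_space \<pi>"
    "\<And>A B. A \<in> sets borel \<Longrightarrow> B \<in> sets borel \<Longrightarrow> measure \<pi> (A \<times> B) = \<mu> (A \<times> B)"
    by (rule sigma_additive_extension) (rule that)
  interpret \<pi>: prob_space \<pi> by (rule \<pi>(2))
  obtain \<B> :: "'a set set" where \<B>: "countable \<B>" "topological_basis \<B>"
    using ex_countable_basis by blast
  let ?I = "{(U, V) \<in> \<B> \<times> \<B>. \<mu> (U \<times> V) = 0}"
  have op: "open U" if "U \<in> \<B>" for U using \<B>(2) that by (rule topological_basis_open)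
  have "(\<Union>(U, V)\<in>?I. U \<times> V) \<in> null_sets \<pi>"
  proof (rule null_sets_UN')
    show "countable ?I" using \<B>(1) by (intro countable_subset[OF _ countable_SIGMA[OF \<B>(1), of "\<lambda>_. \<B>"]]) auto
    show "(case z of (U, V) \<Rightarrow> U \<times> V) \<in> null_sets \<pi>" if "z \<in> ?I" for z
      using that op open_b \<pi>(3) by (auto simp: null_sets_def \<pi>(1) \<pi>.emeasure_eq_measure)
  qed
  moreover have "{z \<in> space \<pi>. z \<notin> \<Gamma>} \<subseteq> (\<Union>(U, V)\<in>?I. U \<times> V)"
  proof
    fix z assume "z \<in> {z \<in> space \<pi>. z \<notin> \<Gamma>}"
    then obtain U V where UV: "open U" "open V" "fst z \<in> U" "snd z \<in> V" "\<not> \<mu> (U \<times> V) > 0"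
      unfolding \<Gamma>_def by (cases z) auto
    obtain U' where U': "U' \<in> \<B>" "fst z \<in> U'" "U' \<subseteq> U" using topological_basisE[OF \<B>(2) UV(1,3)] by blast
    obtain V' where V': "V' \<in> \<B>" "snd z \<in> V'" "V' \<subseteq> V" using topological_basisE[OF \<B>(2) UV(2,4)] by blast
    have "\<mu> (U' \<times> V') \<le> \<mu> (U \<times> V)"
      using U' V' UV op open_b by (intro mono) auto
    then have "\<mu> (U' \<times> V') = 0"
      using UV(5) nonneg[OF open_b[OF op op, OF U'(1) V'(1)]] by linarith
    then show "z \<in> (\<Union>(U, V)\<in>?I. U \<times> V)"
      using U' V' by (intro UN_I[of "(U', V')"]) (auto simp: mem_Times_iff)
  qed
  ultimately have AE: "AE z in \<pi>. z \<in> \<Gamma>" by (rule AE_I')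
  show ?thesis
  proof (rule that[OF \<pi>(1,2) mono_\<Gamma> AE])
    show "measure \<pi> (A \<times> UNIV) = measure P A" if "A \<in> sets borel" for A
      using that \<pi>(3)[of A UNIV] marginal1 by simp
    show "measure \<pi> (UNIV \<times> B) = measure Q B" if "B \<in> sets borel" for B
      using that \<pi>(3)[of UNIV B] marginal2 by simp
  qed
qed

subsection \<open>Rockafellar's potential\<close>

lemma convex_fun_SUP_affine:
  fixes g :: "'i \<Rightarrow> 'a::real_vector \<Rightarrow> real"
  assumes "\<And>i x y t. i \<in> I \<Longrightarrow> g i ((1 - t) *\<^sub>R x + t *\<^sub>R y) = (1 - t) * g i x + t * g i y"
  shows "convex_fun (\<lambda>x. SUP i\<in>I. ereal (g i x))"
  unfolding convex_fun_def
proof (intro allI impI SUP_least)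
  fix x y t i assume t: "0 < t \<and> t < (1::real)" and i: "i \<in> I"
  have "ereal (g i ((1 - t) *\<^sub>R x + t *\<^sub>R y)) = ereal (1 - t) * ereal (g i x) + ereal t * ereal (g i y)"
    by (simp add: assms[OF i])
  also have "\<dots> \<le> ereal (1 - t) * (SUP i\<in>I. ereal (g i x)) + ereal t * (SUP i\<in>I. ereal (g i y))"
    using t i by (intro add_mono ereal_mult_left_mono SUP_upper) auto
  finally show "ereal (g i ((1 - t) *\<^sub>R x + t *\<^sub>R y)) \<le>
      ereal (1 - t) * (SUP i\<in>I. ereal (g i x)) + ereal t * (SUP i\<in>I. ereal (g i y))" .
qed

definition chain_value :: "nat \<times> (nat \<Rightarrow> 'a) \<times> (nat \<Rightarrow> 'a) \<Rightarrow> 'a::real_inner \<Rightarrow> real" where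
  "chain_value = (\<lambda>(n, x, y) z. (\<Sum>i<n. y i \<bullet> (x (Suc i) - x i)) + y n \<bullet> (z - x n))"

theorem Rockafellar_potential:
  fixes \<Gamma> :: "('a::real_inner \<times> 'a) set"
  assumes \<Gamma>: "cyclically_monotone \<Gamma>" and "\<Gamma> \<noteq> {}"
  obtains \<psi> where "proper_lsc_convex \<psi>" "\<And>a b. (a, b) \<in> \<Gamma> \<Longrightarrow> b \<in> subdifferential \<psi> a"
proof -
  obtain x0 y0 where x0: "(x0, y0) \<in> \<Gamma>" using \<open>\<Gamma> \<noteq> {}\<close> by auto
  define I where "I = {(n :: nat, x, y). x 0 = x0 \<and> (\<forall>i\<le>n. (x i, y i) \<in> \<Gamma>)}"
  define \<psi> where "\<psi> z = (SUP c\<in>I. ereal (chain_value c z))" for z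
  have upper: "ereal (chain_value c z) \<le> \<psi> z" if "c \<in> I" for c z
    unfolding \<psi>_def by (rule SUP_upper) fact
  have I0: "(0, \<lambda>_. x0, \<lambda>_. y0) \<in> I" using x0 by (simp add: I_def)
  have ninf: "\<psi> z \<noteq> -\<infinity>" for z using upper[OF I0, of z] by auto
  have "\<psi> x0 \<le> 0"
    unfolding \<psi>_def
  proof (rule SUP_least)
    fix c assume "c \<in> I"
    then obtain n x y where c: "c = (n, x, y)" "x 0 = x0" "\<And>i. i \<le> n \<Longrightarrow> (x i, y i) \<in> \<Gamma>"
      by (cases c) (auto simp: I_def)
    define x' where "x' = x(Suc n := x0)"
    have "(\<Sum>i\<le>n. y i \<bullet> (x' (Suc i) - x' i)) \<le> 0"
      by (rule \<Gamma>[unfolded cyclically_monotone_def, rule_format]) (auto simp: x'_def c)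
    also have "(\<Sum>i\<le>n. y i \<bullet> (x' (Suc i) - x' i)) = chain_value c x0"
      by (simp add: chain_value_def c(1) x'_def flip: lessThan_Suc_atMost)
    finally show "ereal (chain_value c x0) \<le> 0" by simp
  qed
  then have "proper_fun \<psi>" using ninf by (auto simp: proper_fun_def intro!: exI[of _ x0])
  moreover have "lsc_fun \<psi>"
    unfolding \<psi>_def chain_value_def
    by (intro lsc_fun_SUP_continuous) (auto simp: case_prod_beta intro!: continuous_intros)
  moreover have "convex_fun \<psi>"
    unfolding \<psi>_def
    by (intro convex_fun_SUP_affine) (auto simp: chain_value_def algebra_simps inner_simps)
  moreover have "b \<in> subdifferential \<psi> a" if ab: "(a, b) \<in> \<Gamma>" for a b
  proof -
    have "\<psi> a + ereal (b \<bullet> (z - a)) \<le> \<psi> z" for z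
    proof (cases "\<psi> z")
      case (real r)
      have "\<psi> a \<le> ereal (r - b \<bullet> (z - a))"
        unfolding \<psi>_def[of a]
      proof (rule SUP_least)
        fix c assume "c \<in> I"
        then obtain n x y where c: "c = (n, x, y)" "x 0 = x0" "\<And>i. i \<le> n \<Longrightarrow> (x i, y i) \<in> \<Gamma>"
          by (cases c) (auto simp: I_def)
        let ?c = "(Suc n, x(Suc n := a), y(Suc n := b))"
        have "?c \<in> I" using c ab by (auto simp: I_def le_Suc_eq)
        then have "ereal (chain_value ?c z) \<le> ereal r" using upper real by metis
        moreover have "chain_value ?c z = chain_value c a + b \<bullet> (z - a)"
          by (simp add: chain_value_def c(1))
        ultimately show "ereal (chain_value c a) \<le> ereal (r - b \<bullet> (z - a))" by simp
      qed
      then show ?thesis using real by (cases "\<psi> a") auto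
    qed (use ninf in auto)
    then show ?thesis by (simp add: subdifferential_def)
  qed
  ultimately show ?thesis by (intro that[of \<psi>]) (auto simp: proper_lsc_convex_def)
qed

subsection \<open>Existence\<close>

lemma grad_vimage_borel:
  fixes f :: "'a::{real_inner, polish_space} \<Rightarrow> ereal"
  assumes "proper_lsc_convex f" "B \<in> sets borel"
  shows "{x \<in> dom_grad f. grad f x \<in> B} \<in> sets borel"
proof -
  have "grad f -` B \<inter> space (restrict_space borel (dom_grad f)) \<in> sets (restrict_space borel (dom_grad f))"
    by (rule measurable_sets[OF grad_measurable]) fact+
  moreover have "grad f -` B \<inter> space (restrict_space borel (dom_grad f)) = {x \<in> dom_grad f. grad f x \<in> B}"
    by (auto simp: space_restrict_space)
  ultimately show ?thesis
    using dom_grad_borel[OF assms(1)] by (simp add: sets_restrict_space_iff)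
qed

lemma grad_pushes_exists:
  fixes P Q :: "'a::{real_inner, polish_space} measure"
  assumes P: "P \<in> lipschitz_null_measures" and Q: "Q \<in> borel_prob_measures"
  obtains \<psi> where "proper_lsc_convex \<psi>" "grad_pushes \<psi> P Q"
proof -
  have Pb: "P \<in> borel_prob_measures" using P by (simp add: lipschitz_null_measures_def)
  interpret P: prob_space P using Pb by (simp add: borel_prob_measures_def)
  interpret Q: prob_space Q using Q by (simp add: borel_prob_measures_def)
  have sP: "sets P = sets borel" using Pb by (simp add: borel_prob_measures_def)
  obtain \<pi> \<Gamma> where \<pi>: "sets \<pi> = sets borel" "prob_space \<pi>" "cyclically_monotone \<Gamma>" "AE z in \<pi>. z \<in> \<Gamma>"
    "\<And>A. A \<in> sets borel \<Longrightarrow> measure \<pi> (A \<times> UNIV) = measure P A"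
    "\<And>B. B \<in> sets borel \<Longrightarrow> measure \<pi> (UNIV \<times> B) = measure Q B"
    by (rule cyclically_monotone_coupling_exists[OF Pb Q]) (rule that)
  interpret \<pi>: prob_space \<pi> by (rule \<pi>(2))
  have "\<Gamma> \<noteq> {}"
  proof
    assume "\<Gamma> = {}"
    then have "AE z in \<pi>. False" using \<pi>(4) by simp
    then show False by simp
  qed
  then obtain \<psi> where \<psi>: "proper_lsc_convex \<psi>" and sub: "\<And>a b. (a, b) \<in> \<Gamma> \<Longrightarrow> b \<in> subdifferential \<psi> a"
    by (rule Rockafellar_potential[OF \<pi>(3)]) (rule that)
  have multi: "multi_dom \<psi> \<in> null_sets P" by (rule multi_dom_null[OF P \<psi>])
  have "multi_dom \<psi> \<times> UNIV \<in> null_sets \<pi>"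
  proof (rule null_setsI)
    show "multi_dom \<psi> \<times> UNIV \<in> sets \<pi>"
      unfolding \<pi>(1) using multi_dom_borel[OF \<psi>] by (intro sets_borel_Times) auto
    have "measure P (multi_dom \<psi>) = 0" using multi by (simp add: null_sets_def measure_def)
    then show "emeasure \<pi> (multi_dom \<psi> \<times> UNIV) = 0"
      using \<pi>(5)[OF multi_dom_borel[OF \<psi>]] by (simp add: \<pi>.emeasure_eq_measure)
  qed
  then have "AE z in \<pi>. z \<notin> multi_dom \<psi> \<times> UNIV" by (rule AE_not_in)
  with \<pi>(4) have AE: "AE z in \<pi>. fst z \<in> dom_grad \<psi> \<and> grad \<psi> (fst z) = snd z"
  proof eventually_elim
    case (elim z)
    have "snd z \<in> subdifferential \<psi> (fst z)" using sub elim(1) by (metis prod.collapse)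
    moreover have "fst z \<notin> multi_dom \<psi>" using elim(2) by (auto simp: mem_Times_iff)
    ultimately have "fst z \<in> dom_grad \<psi>" unfolding dom_grad_eq by blast
    then show ?case using grad_eqI \<open>snd z \<in> _\<close> by blast
  qed
  have push: "measure P {x \<in> dom_grad \<psi>. grad \<psi> x \<in> B} = measure Q B" if B: "B \<in> sets borel" for B
  proof -
    let ?A = "{x \<in> dom_grad \<psi>. grad \<psi> x \<in> B}"
    have A: "?A \<in> sets borel" by (rule grad_vimage_borel[OF \<psi> B])
    have "measure P ?A = measure \<pi> (?A \<times> UNIV)" by (rule \<pi>(5)[OF A, symmetric])
    also have "\<dots> = measure \<pi> (UNIV \<times> B)"
    proof (rule \<pi>.finite_measure_eq_AE)
      show "AE z in \<pi>. (z \<in> ?A \<times> UNIV) = (z \<in> UNIV \<times> B)"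
        using AE by eventually_elim (auto simp: mem_Times_iff)
    qed (use A B in \<open>auto simp: \<pi>(1) intro: sets_borel_Times\<close>)
    finally show ?thesis using \<pi>(6)[OF B] by simp
  qed
  have "space Q = UNIV" using Q sets_eq_imp_space_eq[of Q borel] by (simp add: borel_prob_measures_def)
  then have "emeasure P (dom_grad \<psi>) = 1"
    using push[of UNIV] Q.prob_space by (simp add: P.emeasure_eq_measure)
  then have "grad_pushes \<psi> P Q"
    unfolding grad_pushes_def by (simp add: push P.emeasure_eq_measure Q.emeasure_eq_measure)
  then show ?thesis using \<psi> that by blast
qed

subsection \<open>Uniqueness\<close>

definition conjugate :: "('a::real_inner \<Rightarrow> ereal) \<Rightarrow> 'a \<Rightarrow> ereal" where
  "conjugate f y = (SUP z\<in>{z. f z \<noteq> \<infinity>}. ereal (y \<bullet> z - real_of_ereal (f z)))"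

lemma conjugate_borel_measurable: "conjugate f \<in> borel_measurable borel"
  unfolding conjugate_def[abs_def]
  by (intro lsc_fun_borel_measurable lsc_fun_SUP_continuous continuous_intros)

lemma Fenchel_Young: "f z = ereal r \<Longrightarrow> ereal (y \<bullet> z - r) \<le> conjugate f y"
  unfolding conjugate_def by (rule SUP_upper2[of z]) auto

lemma conjugate_le_iff:
  assumes f: "proper_fun f" and r: "f x = ereal r"
  shows "conjugate f y \<le> ereal (y \<bullet> x - r) \<longleftrightarrow> y \<in> subdifferential f x"
proof -
  have "conjugate f y \<le> ereal (y \<bullet> x - r) \<longleftrightarrow>
      (\<forall>z. f z \<noteq> \<infinity> \<longrightarrow> y \<bullet> z - real_of_ereal (f z) \<le> y \<bullet> x - r)"
    by (simp add: conjugate_def SUP_le_iff)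
  also have "\<dots> \<longleftrightarrow> (\<forall>z. f x + ereal (y \<bullet> (z - x)) \<le> f z)"
  proof (rule all_cong1)
    fix z
    have "f z \<noteq> -\<infinity>" using f by (simp add: proper_fun_def)
    then show "(f z \<noteq> \<infinity> \<longrightarrow> y \<bullet> z - real_of_ereal (f z) \<le> y \<bullet> x - r) =
        (f x + ereal (y \<bullet> (z - x)) \<le> f z)"
      by (cases "f z") (auto simp: r inner_diff_right)
  qed
  finally show ?thesis by (simp add: subdifferential_def)
qed

lemma conjugate_subgradient:
  assumes f: "proper_fun f" and y: "y \<in> subdifferential f x"
  obtains r where "f x = ereal r" "conjugate f y = ereal (y \<bullet> x - r)"
proof -
  obtain r where r: "f x = ereal r" using subdifferential_finite[OF f y] by auto
  have "conjugate f y \<le> ereal (y \<bullet> x - r)" using conjugate_le_iff[OF f r] y by simp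
  moreover have "ereal (y \<bullet> x - r) \<le> conjugate f y" by (rule Fenchel_Young[of f x, OF r])
  ultimately show ?thesis using that[OF r] by (simp add: antisym)
qed

lemma AE_eq_of_le_equidistributed:
  fixes f g :: "'a \<Rightarrow> real"
  assumes M: "prob_space M" and f: "f \<in> borel_measurable M" and g: "g \<in> borel_measurable M"
    and distr: "distr M borel f = distr M borel g" and le: "AE x in M. f x \<le> g x"
  shows "AE x in M. f x = g x"
proof -
  interpret prob_space M by (rule M)
  have bdd: "integrable M (\<lambda>x. arctan (h x))" if "h \<in> borel_measurable M" for h :: "'a \<Rightarrow> real"
  proof (rule integrable_const_bound[where B="pi / 2"])
    have "\<bar>arctan t\<bar> \<le> pi / 2" for t using arctan_bounded[of t] by linarith
    then show "AE x in M. norm (arctan (h x)) \<le> pi / 2" by simp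
    show "(\<lambda>x. arctan (h x)) \<in> borel_measurable M"
      by (rule borel_measurable_continuous_on[OF _ that]) (intro continuous_intros)
  qed
  have eq: "(\<integral>x. arctan (h x) \<partial>M) = (\<integral>t. arctan t \<partial>distr M borel h)" if "h \<in> borel_measurable M" for h
    using that by (intro integral_distr[symmetric] borel_measurable_continuous_onI continuous_intros)
  have "(\<integral>x. arctan (g x) - arctan (f x) \<partial>M) = 0"
    using bdd[OF f] bdd[OF g] eq[OF f] eq[OF g] distr by simp
  moreover have "AE x in M. 0 \<le> arctan (g x) - arctan (f x)"
    using le by eventually_elim (simp add: arctan_le_iff)
  ultimately have "AE x in M. arctan (g x) - arctan (f x) = 0"
    using integral_nonneg_eq_0_iff_AE[of M "\<lambda>x. arctan (g x) - arctan (f x)"] bdd[OF f] bdd[OF g] by simp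
  then show ?thesis by eventually_elim (simp add: arctan_eq_iff)
qed

definition total_grad :: "('a::real_inner \<Rightarrow> ereal) \<Rightarrow> 'a \<Rightarrow> 'a" where
  "total_grad f x = (if x \<in> dom_grad f then grad f x else 0)"

lemma total_grad_pushes:
  fixes P Q :: "'a::{real_inner, polish_space} measure"
  assumes P: "P \<in> borel_prob_measures" and Q: "Q \<in> borel_prob_measures"
    and f: "proper_lsc_convex f" and push: "grad_pushes f P Q"
  shows "AE x in P. x \<in> dom_grad f" "total_grad f \<in> borel_measurable P" "distr P borel (total_grad f) = Q"
proof -
  interpret P: prob_space P using P by (simp add: borel_prob_measures_def)
  have sP: "sets P = sets borel" and sQ: "sets Q = sets borel"
    using P Q by (auto simp: borel_prob_measures_def)
  have D: "dom_grad f \<in> sets P" using dom_grad_borel[OF f] by (simp add: sP)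
  show AE: "AE x in P. x \<in> dom_grad f"
    using push D by (simp add: grad_pushes_def P.emeasure_eq_measure P.AE_in_set_eq_1)
  have "(\<lambda>x. if x \<in> dom_grad f then grad f x else 0) \<in> borel_measurable borel"
    using dom_grad_borel[OF f] grad_measurable[OF f]
    by (subst measurable_If_restrict_space_iff) (auto simp: pred_def)
  then show meas: "total_grad f \<in> borel_measurable P"
    by (simp add: total_grad_def[abs_def] measurable_cong_sets[OF sP refl])
  show "distr P borel (total_grad f) = Q"
  proof (rule measure_eqI)
    fix B assume "B \<in> sets (distr P borel (total_grad f))"
    then have B: "B \<in> sets borel" by simp
    have "emeasure (distr P borel (total_grad f)) B = emeasure P (total_grad f -` B \<inter> space P)"
      by (rule emeasure_distr[OF meas B])
    also have "\<dots> = emeasure P {x \<in> dom_grad f. grad f x \<in> B}"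
    proof (rule emeasure_eq_AE)
      show "AE x in P. (x \<in> total_grad f -` B \<inter> space P) = (x \<in> {x \<in> dom_grad f. grad f x \<in> B})"
        using AE AE_space by eventually_elim (auto simp: total_grad_def)
      show "total_grad f -` B \<inter> space P \<in> sets P" by (rule measurable_sets[OF meas B])
      show "{x \<in> dom_grad f. grad f x \<in> B} \<in> sets P" using grad_vimage_borel[OF f B] by (simp add: sP)
    qed
    also have "\<dots> = emeasure Q B" using push B by (simp add: grad_pushes_def)
    finally show "emeasure (distr P borel (total_grad f)) B = emeasure Q B" .
  qed (simp add: sQ)
qed

lemma grad_pushes_unique:
  fixes P Q :: "'a::{real_inner, polish_space} measure"
  assumes P: "P \<in> borel_prob_measures" and Q: "Q \<in> borel_prob_measures"
    and f: "proper_lsc_convex f" "grad_pushes f P Q" and g: "proper_lsc_convex g" "grad_pushes g P Q"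
  shows "AE x in P. x \<in> dom_grad f \<and> x \<in> dom_grad g \<and> grad f x = grad g x"
proof -
  have prob: "prob_space P" using P by (simp add: borel_prob_measures_def)
  have pf: "proper_fun f" and pg: "proper_fun g" using f g by (auto simp: proper_lsc_convex_def)
  note F = total_grad_pushes[OF P Q f] and G = total_grad_pushes[OF P Q g]
  have sub: "total_grad h x \<in> subdifferential h x" if "x \<in> dom_grad h" for h x
    using subdifferential_dom_grad[OF that] that by (simp add: total_grad_def)
  have finite: "AE y in Q. \<bar>conjugate h y\<bar> \<noteq> \<infinity>"
    if h: "proper_fun h" "AE x in P. x \<in> dom_grad h" "total_grad h \<in> borel_measurable P"
      "distr P borel (total_grad h) = Q" for h
  proof -
    have meas: "{y. \<bar>conjugate h y\<bar> \<noteq> \<infinity>} \<in> sets borel"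
    proof -
      have "conjugate h -` (- {\<infinity>, -\<infinity>}) \<inter> space borel \<in> sets borel"
        by (rule measurable_sets[OF conjugate_borel_measurable]) auto
      moreover have "\<bar>c\<bar> \<noteq> \<infinity> \<longleftrightarrow> c \<in> - {\<infinity>, -\<infinity>}" for c :: ereal by (cases c) auto
      ultimately show ?thesis by (simp add: vimage_def)
    qed
    have "AE x in P. \<bar>conjugate h (total_grad h x)\<bar> \<noteq> \<infinity>"
      using h(2)
    proof eventually_elim
      case (elim x)
      obtain r where "conjugate h (total_grad h x) = ereal (total_grad h x \<bullet> x - r)"
        by (rule conjugate_subgradient[OF h(1) sub[OF elim]])
      then show ?case by simp
    qed
    then have "AE y in distr P borel (total_grad h). \<bar>conjugate h y\<bar> \<noteq> \<infinity>"
      by (subst AE_distr_iff[OF h(3)]) (use meas in auto)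
    then show ?thesis unfolding h(4) .
  qed
  have fin: "AE x in P. \<bar>conjugate f (total_grad g x)\<bar> \<noteq> \<infinity>"
    by (rule AE_distrD[OF G(2), where P="\<lambda>y. \<bar>conjugate f y\<bar> \<noteq> \<infinity>"]) (simp only: G(3) finite[OF pf F])
  have fin': "AE x in P. \<bar>conjugate g (total_grad f x)\<bar> \<noteq> \<infinity>"
    by (rule AE_distrD[OF F(2), where P="\<lambda>y. \<bar>conjugate g y\<bar> \<noteq> \<infinity>"]) (simp only: F(3) finite[OF pg G])
  define w where "w y = real_of_ereal (conjugate f y) - real_of_ereal (conjugate g y)" for y
  have w: "w \<in> borel_measurable borel"
    unfolding w_def
    by (intro borel_measurable_diff borel_measurable_real_of_ereal conjugate_borel_measurable)
  have sandwich: "AE x in P. w (total_grad f x) \<le> real_of_ereal (g x) - real_of_ereal (f x) \<and>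
      real_of_ereal (g x) - real_of_ereal (f x) \<le> w (total_grad g x)"
    using F(1) G(1) fin fin'
  proof eventually_elim
    case (elim x)
    let ?F = "total_grad f x" and ?G = "total_grad g x"
    obtain r where r: "f x = ereal r" "conjugate f ?F = ereal (?F \<bullet> x - r)"
      by (rule conjugate_subgradient[OF pf sub[OF elim(1)]])
    obtain s where s: "g x = ereal s" "conjugate g ?G = ereal (?G \<bullet> x - s)"
      by (rule conjugate_subgradient[OF pg sub[OF elim(2)]])
    obtain a where a: "conjugate f ?G = ereal a" using elim(3) by auto
    obtain b where b: "conjugate g ?F = ereal b" using elim(4) by auto
    have "?G \<bullet> x - r \<le> a" using Fenchel_Young[of f x r ?G, OF r(1)] by (simp add: a)
    moreover have "?F \<bullet> x - s \<le> b" using Fenchel_Young[of g x s ?F, OF s(1)] by (simp add: b)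
    ultimately show ?case by (simp add: w_def r s a b)
  qed
  have "AE x in P. w (total_grad f x) = w (total_grad g x)"
  proof (rule AE_eq_of_le_equidistributed[OF prob])
    show "(\<lambda>x. w (total_grad f x)) \<in> borel_measurable P" "(\<lambda>x. w (total_grad g x)) \<in> borel_measurable P"
      using measurable_compose[OF F(2) w] measurable_compose[OF G(2) w] by auto
    have "distr P borel (\<lambda>x. w (total_grad h x)) = distr Q borel w"
      if "total_grad h \<in> borel_measurable P" "distr P borel (total_grad h) = Q" for h
      using distr_distr[OF w that(1)] that(2) by (simp add: comp_def)
    then show "distr P borel (\<lambda>x. w (total_grad f x)) = distr P borel (\<lambda>x. w (total_grad g x))"
      using F(2,3) G(2,3) by simp
    show "AE x in P. w (total_grad f x) \<le> w (total_grad g x)"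
      using sandwich by eventually_elim linarith
  qed
  with sandwich F(1) G(1) fin fin' show ?thesis
  proof eventually_elim
    case (elim x)
    let ?G = "total_grad g x"
    obtain r where r: "f x = ereal r"
      using subdifferential_finite[OF pf sub[OF elim(2)]] by auto
    obtain s where s: "g x = ereal s" "conjugate g ?G = ereal (?G \<bullet> x - s)"
      by (rule conjugate_subgradient[OF pg sub[OF elim(3)]])
    obtain a where a: "conjugate f ?G = ereal a" using elim(4) by auto
    have "w ?G = s - r" using elim(1,6) by (simp add: r s)
    then have "conjugate f ?G \<le> ereal (?G \<bullet> x - r)" by (simp add: w_def a s)
    then have "?G \<in> subdifferential f x" using conjugate_le_iff[OF pf r] by simp
    then have "grad f x = ?G" by (rule grad_eqI[OF elim(2)])
    then show ?case using elim by (simp add: total_grad_def)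
  qed
qed

theorem theorem2p3:
  fixes P Q :: "'h::{real_inner, polish_space} measure"
  assumes "Q \<in> borel_prob_measures"
  shows "(P \<in> lipschitz_null_measures \<longrightarrow>
            (\<exists>\<psi>. proper_lsc_convex \<psi> \<and> grad_pushes \<psi> P Q)) \<and>
         (P \<in> lipschitz_null_measures \<and> bounded (measure_supp Q) \<longrightarrow>
            (\<forall>\<psi>1 \<psi>2. proper_lsc_convex \<psi>1 \<and> proper_lsc_convex \<psi>2 \<and>
                grad_pushes \<psi>1 P Q \<and> grad_pushes \<psi>2 P Q \<longrightarrow>
                (AE x in P. x \<in> dom_grad \<psi>1 \<and> x \<in> dom_grad \<psi>2 \<and> grad \<psi>1 x = grad \<psi>2 x)))"
proof (intro conjI impI allI; (elim conjE)?)
  assume "P \<in> lipschitz_null_measures"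
  then show "\<exists>\<psi>. proper_lsc_convex \<psi> \<and> grad_pushes \<psi> P Q"
    by (rule grad_pushes_exists[OF _ assms]) blast
next
  fix \<psi>1 \<psi>2 :: "'h \<Rightarrow> ereal"
  assume "P \<in> lipschitz_null_measures"
    and push: "proper_lsc_convex \<psi>1" "proper_lsc_convex \<psi>2" "grad_pushes \<psi>1 P Q" "grad_pushes \<psi>2 P Q"
  then have "P \<in> borel_prob_measures" by (simp add: lipschitz_null_measures_def)
  then show "AE x in P. x \<in> dom_grad \<psi>1 \<and> x \<in> dom_grad \<psi>2 \<and> grad \<psi>1 x = grad \<psi>2 x"
    by (rule grad_pushes_unique[OF _ assms push(1,3,2,4)])
qed

end
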